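(* Let $(A,\alpha,\epsilon)$ be a unital commutative symmetric imprimitive Kreĭn C*-algebra with fundamental symmetry $\alpha$ and odd symmetry $\epsilon$ (compatible with $\alpha$). Then the Gel'fand transform $$\varphi: A\to C(\Omega_b(A,\alpha),\mathbb{K}),\qquad a\mapsto \hat a,$$ is an isometric $*$-isomorphism.
   Context: A Banach $*$-algebra is a complex associative algebra with a complete submultiplicative norm and a conjugate-linear anti-multiplicative involution $*$. A Kreĭn C*-algebra is a Banach $*$-algebra $A$ admitting at least one fundamental symmetry, i.e. a $*$-automorphism $\alpha:A\to A$ with $\alpha\circ\alpha=\mathrm{id}_A$ and $\|\alpha(a^* )a\|=\|a\|^2$ for all $a\in A$. Put $A_+=\{x:\alpha(x)=x\}$, $A_-=\{x:\alpha(x)=-x\}$, so $A=A_+\oplus A_-$ and $x=x_++x_-$. Put $x^{\dag_\alpha}:=\alpha(x)^*$. $A_-$ is an $A_+$-$A_+$ Hilbert C*-bimodule under multiplication of $A$ with inner products ${}_{A_+}\langle x\mid y\rangle=xy^{\dag_\alpha}$, $\langle x\mid y\rangle_{A_+}=x^{\dag_\alpha}y$. $(A,\alpha)$ is imprimitive (or full) if $A_-$ is an imprimitivity bimodule over $A_+$, i.e. ${}_{A_+}\langle x\mid y\rangle z=x\langle y\mid z\rangle_{A_+}$ for all $x,y,z\in A_-$ (automatic here) and the closed linear spans of $\{x^{\dag_\alpha}y: x,y\in A_-\}$ and of $\{xy^{\dag_\alpha}: x,y\in A_-\}$ both equal $A_+$. An odd symmetry of $A$ is a linear map $\epsilon:A\to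 A$ with $\epsilon\circ\epsilon=\mathrm{id}_A$, $\epsilon(x^* )=-\epsilon(x)^*$ and $\epsilon(xy)=\epsilon(x)y=x\epsilon(y)$ for all $x,y\in A$; it is compatible with $\alpha$ if $\epsilon\circ\alpha=-\alpha\circ\epsilon$. $A$ is symmetric if it has an odd symmetry compatible with some fundamental symmetry. $\mathbb{K}$ is the algebra of matrices $T_{a,b}=\begin{bmatrix} a & b \\ b & a \end{bmatrix}$, $a,b\in\mathbb{C}$, with usual matrix operations, operator norm, involution $T_{a,b}^*=T_{\bar a,-\bar b}$, fundamental symmetry $\gamma(T_{a,b})=T_{a,-b}$ and odd symmetry $\epsilon_{\mathbb{K}}(T_{a,b})=T_{b,a}$. $\Omega(A,\alpha)$ is the set of unital $*$-homomorphisms $w:A\to\mathbb{K}$ with $w\circ\alpha=\gamma\circ w$, with the smallest topology making all evaluations $w\mapsto w(a)$, $a\in A$, continuous. Define $w_1\sim w_2$ iff $w_2=\phi\circ w_1$ for some unital $*$-automorphism $\phi$ of $\mathbb{K}$; then $[w]=\{w,\gamma\circ w\}$. $\Omega_b(A,\alpha)$ is the set of equivalence classes in $\Omega(A,\alpha)$ with the quotient topology. The Gel'fand transform of $x\in A$ is $\hat x:\Omega_b(A,\alpha)\to\mathbb{K}$, $\hat x([w])=w(x_+)+(\epsilon_{\mathbb{K}}\circ w\circ\epsilon)(x_-)$. For a compact Hausdorff space $M$, $C(M,\mathbb{K})$ is the algebra of continuous functions $M\to\mathbb{K}$ with pointwise operations, pointwise involution and norm $\|f\|=\sup_{x\in M}\|f(x)\|$.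 *)

theory Defs
  imports "HOL-Analysis.Analysis"
begin

section \<open>Banach star-algebras\<close>

text \<open>
  Algebras are types of class \<open>banach_star_algebra\<close>.  No unit is assumed, and the involution
  is not assumed to be isometric.  A unit is added through the sort \<open>monoid_mult\<close>, a unit
  and commutativity through \<open>comm_monoid_mult\<close>; neither excludes the zero algebra.
\<close>

class banach_star_algebra = real_normed_algebra + banach +
  fixes scaleC :: "complex \<Rightarrow> 'a \<Rightarrow> 'a"  (infixr "*\<^sub>C" 75)
    and star :: "'a \<Rightarrow> 'a"
  assumes scaleR_scaleC: "r *\<^sub>R x = complex_of_real r *\<^sub>C x"
    and scaleC_add_right: "c *\<^sub>C (x + y) = c *\<^sub>C x + c *\<^sub>C y"
    and scaleC_add_left: "(c + d) *\<^sub>C x = c *\<^sub>C x + d *\<^sub>C x"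
    and scaleC_scaleC: "c *\<^sub>C (d *\<^sub>C x) = (c * d) *\<^sub>C x"
    and mult_scaleC_left: "(c *\<^sub>C x) * y = c *\<^sub>C (x * y)"
    and mult_scaleC_right: "x * (c *\<^sub>C y) = c *\<^sub>C (x * y)"
    and norm_scaleC: "norm (c *\<^sub>C x) = cmod c * norm x"
    and star_star: "star (star x) = x"
    and star_add: "star (x + y) = star x + star y"
    and star_scaleC: "star (c *\<^sub>C x) = cnj c *\<^sub>C star x"
    and star_mult: "star (x * y) = star y * star x"

lemma scaleC_one: "1 *\<^sub>C (x :: 'a::banach_star_algebra) = x"
  by (metis of_real_1 scaleR_one scaleR_scaleC)

global_interpretation complex_vector:
  vector_space "scaleC :: complex \<Rightarrow> 'a \<Rightarrow> 'a::banach_star_algebra"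
  by unfold_locales
    (simp_all add: scaleC_add_right scaleC_add_left scaleC_scaleC scaleC_one)

definition complex_linear ::
    "('a::banach_star_algebra \<Rightarrow> 'b::banach_star_algebra) \<Rightarrow> bool"
  where "complex_linear = Vector_Spaces.linear scaleC scaleC"

lemma complex_linear_iff:
  "complex_linear f \<longleftrightarrow> (\<forall>x y. f (x + y) = f x + f y) \<and> (\<forall>c x. f (c *\<^sub>C x) = c *\<^sub>C f x)"
  unfolding complex_linear_def
  by (simp add: Vector_Spaces.linear_iff complex_vector.vector_space_axioms)

definition star_hom :: "('a::banach_star_algebra \<Rightarrow> 'b::banach_star_algebra) \<Rightarrow> bool"
  where "star_hom f \<longleftrightarrow> complex_linear f \<and>
    (\<forall>x y. f (x * y) = f x * f y) \<and> (\<forall>x. f (star x) = star (f x))"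

definition unital_star_hom ::
    "('a::{banach_star_algebra,monoid_mult} \<Rightarrow> 'b::{banach_star_algebra,monoid_mult}) \<Rightarrow> bool"
  where "unital_star_hom f \<longleftrightarrow> star_hom f \<and> f 1 = 1"


section \<open>Krein C*-algebras\<close>

definition fundamental_symmetry :: "('a::banach_star_algebra \<Rightarrow> 'a) \<Rightarrow> bool"
  where "fundamental_symmetry \<alpha> \<longleftrightarrow> star_hom \<alpha> \<and> bij \<alpha> \<and> \<alpha> \<circ> \<alpha> = id \<and>
    (\<forall>a. norm (\<alpha> (star a) * a) = (norm a)\<^sup>2)"

definition even_part :: "('a::banach_star_algebra \<Rightarrow> 'a) \<Rightarrow> 'a set"
  where "even_part \<alpha> = {x. \<alpha> x = x}"

definition odd_part :: "('a::banach_star_algebra \<Rightarrow> 'a) \<Rightarrow> 'a set"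
  where "odd_part \<alpha> = {x. \<alpha> x = - x}"

definition even_comp :: "('a::banach_star_algebra \<Rightarrow> 'a) \<Rightarrow> 'a \<Rightarrow> 'a"
  where "even_comp \<alpha> x = (1/2) *\<^sub>R (x + \<alpha> x)"

definition odd_comp :: "('a::banach_star_algebra \<Rightarrow> 'a) \<Rightarrow> 'a \<Rightarrow> 'a"
  where "odd_comp \<alpha> x = (1/2) *\<^sub>R (x - \<alpha> x)"

lemma fundamental_symmetry_simps:
  assumes "fundamental_symmetry \<alpha>"
  shows "\<alpha> (x + y) = \<alpha> x + \<alpha> y" "\<alpha> (x - y) = \<alpha> x - \<alpha> y" "\<alpha> (- x) = - \<alpha> x"
    "\<alpha> (r *\<^sub>R x) = r *\<^sub>R \<alpha> x" "\<alpha> (\<alpha> x) = x"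
proof -
  have lin: "\<alpha> (x + y) = \<alpha> x + \<alpha> y" "\<alpha> (c *\<^sub>C x) = c *\<^sub>C \<alpha> x" for x y c
    using assms by (auto simp: fundamental_symmetry_def star_hom_def complex_linear_iff)
  show "\<alpha> (x + y) = \<alpha> x + \<alpha> y" by (rule lin)
  have sR: "\<alpha> (r *\<^sub>R x) = r *\<^sub>R \<alpha> x" for r x by (simp add: scaleR_scaleC lin)
  then show "\<alpha> (r *\<^sub>R x) = r *\<^sub>R \<alpha> x" .
  have neg: "\<alpha> (- x) = - \<alpha> x" for x using sR[of "-1" x] by simp
  then show "\<alpha> (- x) = - \<alpha> x" .
  show "\<alpha> (x - y) = \<alpha> x - \<alpha> y" using lin(1)[of x "- y"] neg by simp
  show "\<alpha> (\<alpha> x) = x"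
    using assms by (metis fundamental_symmetry_def comp_apply id_apply)
qed

lemma even_odd_decomposition:
  assumes \<alpha>: "fundamental_symmetry \<alpha>"
  shows "even_comp \<alpha> x \<in> even_part \<alpha> \<and> odd_comp \<alpha> x \<in> odd_part \<alpha> \<and>
    x = even_comp \<alpha> x + odd_comp \<alpha> x"
    and "p \<in> even_part \<alpha> \<Longrightarrow> q \<in> odd_part \<alpha> \<Longrightarrow> even_comp \<alpha> (p + q) = p \<and> odd_comp \<alpha> (p + q) = q"
proof -
  have half: "(1/2) *\<^sub>R z + (1/2) *\<^sub>R z = z" for z :: 'a
    by (simp flip: scaleR_add_left)
  show "even_comp \<alpha> x \<in> even_part \<alpha> \<and> odd_comp \<alpha> x \<in> odd_part \<alpha> \<and>
    x = even_comp \<alpha> x + odd_comp \<alpha> x"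
    using half[of x]
    by (simp add: even_part_def odd_part_def even_comp_def odd_comp_def
        fundamental_symmetry_simps[OF \<alpha>] algebra_simps)
  show "p \<in> even_part \<alpha> \<Longrightarrow> q \<in> odd_part \<alpha> \<Longrightarrow> even_comp \<alpha> (p + q) = p \<and> odd_comp \<alpha> (p + q) = q"
    using half[of p] half[of q]
    by (simp add: even_part_def odd_part_def even_comp_def odd_comp_def
        fundamental_symmetry_simps[OF \<alpha>] algebra_simps)
qed

definition dagger :: "('a::banach_star_algebra \<Rightarrow> 'a) \<Rightarrow> 'a \<Rightarrow> 'a"
  where "dagger \<alpha> x = star (\<alpha> x)"

text \<open>The two \<open>even_part \<alpha>\<close>-valued inner products on \<open>odd_part \<alpha>\<close>.\<close>

definition left_inner :: "('a::banach_star_algebra \<Rightarrow> 'a) \<Rightarrow> 'a \<Rightarrow> 'a \<Rightarrow> 'a"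
  where "left_inner \<alpha> x y = x * dagger \<alpha> y"

definition right_inner :: "('a::banach_star_algebra \<Rightarrow> 'a) \<Rightarrow> 'a \<Rightarrow> 'a \<Rightarrow> 'a"
  where "right_inner \<alpha> x y = dagger \<alpha> x * y"

definition imprimitive :: "('a::banach_star_algebra \<Rightarrow> 'a) \<Rightarrow> bool"
  where "imprimitive \<alpha> \<longleftrightarrow>
    (\<forall>x \<in> odd_part \<alpha>. \<forall>y \<in> odd_part \<alpha>. \<forall>z \<in> odd_part \<alpha>.
       left_inner \<alpha> x y * z = x * right_inner \<alpha> y z) \<and>
    closure (complex_vector.span
       {right_inner \<alpha> x y | x y. x \<in> odd_part \<alpha> \<and> y \<in> odd_part \<alpha>}) = even_part \<alpha> \<and>
    closure (complex_vector.span
       {left_inner \<alpha> x y | x y. x \<in> odd_part \<alpha> \<and> y \<in> odd_part \<alpha>}) = even_part \<alpha>"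

definition odd_symmetry :: "('a::banach_star_algebra \<Rightarrow> 'a) \<Rightarrow> bool"
  where "odd_symmetry \<epsilon> \<longleftrightarrow> complex_linear \<epsilon> \<and> \<epsilon> \<circ> \<epsilon> = id \<and>
    (\<forall>x. \<epsilon> (star x) = - star (\<epsilon> x)) \<and>
    (\<forall>x y. \<epsilon> (x * y) = \<epsilon> x * y \<and> \<epsilon> (x * y) = x * \<epsilon> y)"

definition compatible_symmetries ::
    "('a::banach_star_algebra \<Rightarrow> 'a) \<Rightarrow> ('a \<Rightarrow> 'a) \<Rightarrow> bool"
  where "compatible_symmetries \<alpha> \<epsilon> \<longleftrightarrow> (\<forall>x. \<epsilon> (\<alpha> x) = - \<alpha> (\<epsilon> x))"


section \<open>The algebra K of matrices \<open>T a b\<close>\<close>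

definition Tmat :: "complex \<Rightarrow> complex \<Rightarrow> complex^2^2"
  where "Tmat a b = vector [vector [a, b], vector [b, a]]"

lemma Tmat_nth [simp]:
  "Tmat a b $ 1 $ 1 = a" "Tmat a b $ 1 $ 2 = b" "Tmat a b $ 2 $ 1 = b" "Tmat a b $ 2 $ 2 = a"
  by (simp_all add: Tmat_def)

lemma mat2_eq_iff:
  "(M :: complex^2^2) = N \<longleftrightarrow>
     M$1$1 = N$1$1 \<and> M$1$2 = N$1$2 \<and> M$2$1 = N$2$1 \<and> M$2$2 = N$2$2"
  by (auto simp: vec_eq_iff forall_2)

typedef kmat = "{M. \<exists>a b. M = Tmat a b}"
  by auto

setup_lifting type_definition_kmat

lift_definition T :: "complex \<Rightarrow> complex \<Rightarrow> kmat" is Tmat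
  by auto

lemma T_cases [cases type: kmat]: obtains a b where "x = T a b"
  by transfer auto

lemma T_eq_iff [simp]: "T a b = T c d \<longleftrightarrow> a = c \<and> b = d"
  by transfer (auto simp: mat2_eq_iff)

lemma Tmat_ops:
  "Tmat a b + Tmat c d = Tmat (a + c) (b + d)"
  "Tmat a b - Tmat c d = Tmat (a - c) (b - d)"
  "- Tmat a b = Tmat (- a) (- b)"
  "0 = Tmat 0 0" "mat 1 = Tmat 1 0"
  "Tmat a b ** Tmat c d = Tmat (a * c + b * d) (a * d + b * c)"
  "r *\<^sub>R Tmat a b = Tmat (of_real r * a) (of_real r * b)"
  "(\<chi> i j. z * Tmat a b $ i $ j) = Tmat (z * a) (z * b)"
  by (simp_all add: mat2_eq_iff matrix_matrix_mult_def sum_2 mat_def scaleR_conv_of_real[where 'a=complex])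

lemma norm_Tmat_mult_sq:
  "(norm (Tmat a b *v v))\<^sup>2 =
    ((cmod (a + b))\<^sup>2 * (cmod (v$1 + v$2))\<^sup>2 + (cmod (a - b))\<^sup>2 * (cmod (v$1 - v$2))\<^sup>2) / 2"
proof -
  have par: "(cmod x)\<^sup>2 + (cmod y)\<^sup>2 = ((cmod (x + y))\<^sup>2 + (cmod (x - y))\<^sup>2) / 2" for x y
    by (simp only: cmod_power2) (simp add: power2_eq_square algebra_simps)
  have "(norm (Tmat a b *v v))\<^sup>2 = (cmod (a * v$1 + b * v$2))\<^sup>2 + (cmod (b * v$1 + a * v$2))\<^sup>2"
    by (simp add: norm_vec_def L2_set_def sum_2 matrix_vector_mult_def)
  also have "\<dots> = ((cmod ((a + b) * (v$1 + v$2)))\<^sup>2 + (cmod ((a - b) * (v$1 - v$2)))\<^sup>2) / 2"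
    unfolding par[of "a * v$1 + b * v$2"] by (simp add: algebra_simps)
  finally show ?thesis by (simp add: norm_mult power_mult_distrib)
qed

lemma onorm_Tmat: "onorm ((*v) (Tmat a b)) = max (cmod (a + b)) (cmod (a - b))"
proof (rule antisym)
  let ?m = "max (cmod (a + b)) (cmod (a - b))"
  have m0: "0 \<le> ?m" by (simp add: le_max_iff_disj)
  have nv: "(norm v)\<^sup>2 = ((cmod (v$1 + v$2))\<^sup>2 + (cmod (v$1 - v$2))\<^sup>2) / 2" for v :: "complex^2"
    using norm_Tmat_mult_sq[of 1 0 v] by (simp flip: Tmat_ops(5))
  show "onorm ((*v) (Tmat a b)) \<le> ?m"
  proof (rule onorm_bound[OF m0])
    fix v :: "complex^2"
    have "(norm (Tmat a b *v v))\<^sup>2 \<le> (?m\<^sup>2 * (cmod (v$1 + v$2))\<^sup>2 + ?m\<^sup>2 * (cmod (v$1 - v$2))\<^sup>2) / 2"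
      unfolding norm_Tmat_mult_sq
      by (intro divide_right_mono add_mono mult_right_mono power_mono) auto
    also have "\<dots> = (?m * norm v)\<^sup>2"
      by (simp add: nv power_mult_distrib algebra_simps)
    finally show "norm (Tmat a b *v v) \<le> ?m * norm v"
      using m0 by (meson mult_nonneg_nonneg norm_ge_zero power2_le_imp_le)
  qed
  have bl: "bounded_linear ((*v) (Tmat a b))" by (simp add: matrix_vector_mul_bounded_linear)
  have low: "c \<le> onorm ((*v) (Tmat a b))"
    if "(norm (Tmat a b *v v))\<^sup>2 = c\<^sup>2 * (norm v)\<^sup>2" "0 \<le> c" "(norm v)\<^sup>2 = 2" for c v
  proof -
    have "(norm (Tmat a b *v v))\<^sup>2 = (c * norm v)\<^sup>2"
      using that by (simp add: power_mult_distrib)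
    then have "norm (Tmat a b *v v) = c * norm v"
      using that(2) by (simp add: power2_eq_iff_nonneg)
    moreover have "norm (Tmat a b *v v) \<le> onorm ((*v) (Tmat a b)) * norm v"
      by (rule onorm[OF bl])
    moreover have "norm v > 0" using that(3) by fastforce
    ultimately show ?thesis by simp
  qed
  have "(norm (vector [1, 1] :: complex^2))\<^sup>2 = 2" "(norm (vector [1, -1] :: complex^2))\<^sup>2 = 2"
    by (simp_all add: nv)
  then have "cmod (a + b) \<le> onorm ((*v) (Tmat a b))" "cmod (a - b) \<le> onorm ((*v) (Tmat a b))"
    using low[of "vector [1, 1]" "cmod (a + b)"] low[of "vector [1, -1]" "cmod (a - b)"]
    by (simp_all add: norm_Tmat_mult_sq)
  then show "?m \<le> onorm ((*v) (Tmat a b))" by simp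
qed

instantiation kmat :: comm_ring_1
begin

lift_definition zero_kmat :: kmat is 0 using Tmat_ops(4) by blast
lift_definition one_kmat :: kmat is "mat 1" using Tmat_ops(5) by blast
lift_definition plus_kmat :: "kmat \<Rightarrow> kmat \<Rightarrow> kmat" is "(+)" by (metis Tmat_ops(1))
lift_definition minus_kmat :: "kmat \<Rightarrow> kmat \<Rightarrow> kmat" is "(-)" by (metis Tmat_ops(2))
lift_definition uminus_kmat :: "kmat \<Rightarrow> kmat" is uminus by (metis Tmat_ops(3))
lift_definition times_kmat :: "kmat \<Rightarrow> kmat \<Rightarrow> kmat" is "(**)" by (metis Tmat_ops(6))

lemma T_ring_ops:
  "T a b + T c d = T (a + c) (b + d)"
  "T a b - T c d = T (a - c) (b - d)"
  "- T a b = T (- a) (- b)"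
  "0 = T 0 0" "1 = T 1 0"
  "T a b * T c d = T (a * c + b * d) (a * d + b * c)"
  by (transfer, simp add: Tmat_ops)+

instance
proof
  fix x y z :: kmat
  obtain a b a' b' a'' b'' where T: "x = T a b" "y = T a' b'" "z = T a'' b''"
    by (metis T_cases)
  show "x + y + z = x + (y + z)" "x + y = y + x" "0 + x = x" "- x + x = 0" "x - y = x + - y"
    "x * y * z = x * (y * z)" "x * y = y * x" "1 * x = x" "(x + y) * z = x * z + y * z"
    "(0::kmat) \<noteq> 1"
    by (simp_all add: T T_ring_ops algebra_simps)
qed

end

text \<open>
  The norm is the operator norm on \<open>complex^2\<close> with its Euclidean norm; the norm that the
  library puts on \<open>complex^2^2\<close> itself is a different one.
\<close>

instantiation kmat :: real_normed_algebra
begin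

lift_definition scaleR_kmat :: "real \<Rightarrow> kmat \<Rightarrow> kmat" is scaleR by (metis Tmat_ops(7))
lift_definition norm_kmat :: "kmat \<Rightarrow> real" is "\<lambda>M. onorm ((*v) M)" .
definition dist_kmat :: "kmat \<Rightarrow> kmat \<Rightarrow> real" where "dist_kmat x y = norm (x - y)"
definition sgn_kmat :: "kmat \<Rightarrow> kmat" where "sgn_kmat x = inverse (norm x) *\<^sub>R x"
definition uniformity_kmat :: "(kmat \<times> kmat) filter"
  where "uniformity_kmat = (INF e\<in>{0<..}. principal {(x, y). dist x y < e})"
definition open_kmat :: "kmat set \<Rightarrow> bool"
  where "open_kmat U \<longleftrightarrow> (\<forall>x\<in>U. eventually (\<lambda>(x', y). x' = x \<longrightarrow> y \<in> U) uniformity)"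

lemma T_normed_ops:
  "r *\<^sub>R T a b = T (of_real r * a) (of_real r * b)"
  "norm (T a b) = max (cmod (a + b)) (cmod (a - b))"
  by (transfer, simp add: Tmat_ops onorm_Tmat)+

instance
proof
  fix x y :: kmat and r s :: real
  show "dist x y = norm (x - y)" by (rule dist_kmat_def)
  show "sgn x = inverse (norm x) *\<^sub>R x" by (rule sgn_kmat_def)
  show "uniformity = (INF e\<in>{0<..}. principal {(x, y :: kmat). dist x y < e})"
    by (rule uniformity_kmat_def)
  show "open U \<longleftrightarrow> (\<forall>x\<in>U. \<forall>\<^sub>F (x', y) in uniformity. x' = x \<longrightarrow> y \<in> U)" for U :: "kmat set"
    by (rule open_kmat_def)
  obtain a b a' b' where T: "x = T a b" "y = T a' b'"
    by (metis T_cases)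
  note ops = T T_ring_ops T_normed_ops
  show "r *\<^sub>R (x + y) = r *\<^sub>R x + r *\<^sub>R y" "(r + s) *\<^sub>R x = r *\<^sub>R x + s *\<^sub>R x"
    "r *\<^sub>R s *\<^sub>R x = (r * s) *\<^sub>R x" "1 *\<^sub>R x = x"
    "r *\<^sub>R x * y = r *\<^sub>R (x * y)" "x * r *\<^sub>R y = r *\<^sub>R (x * y)"
    by (simp_all add: ops algebra_simps)
  show "norm x = 0 \<longleftrightarrow> x = 0"
  proof
    assume "norm x = 0"
    then have "cmod (a + b) \<le> 0" "cmod (a - b) \<le> 0"
      by (metis ops(1,10) max.cobounded1 max.cobounded2)+
    then show "x = 0" by (simp add: ops)
  qed (simp add: ops)
  show "norm (x + y) \<le> norm x + norm y"
  proof -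
    have "cmod (a + a' + (b + b')) \<le> cmod (a + b) + cmod (a' + b')"
      using norm_triangle_ineq[of "a + b" "a' + b'"] by (simp add: algebra_simps)
    moreover have "cmod (a + a' - (b + b')) \<le> cmod (a - b) + cmod (a' - b')"
      using norm_triangle_ineq[of "a - b" "a' - b'"] by (simp add: algebra_simps)
    ultimately show ?thesis by (auto simp: ops)
  qed
  show "norm (r *\<^sub>R x) = \<bar>r\<bar> * norm x"
    by (simp add: ops max_mult_distrib_left norm_mult flip: distrib_left right_diff_distrib)
  show "norm (x * y) \<le> norm x * norm y"
  proof -
    have "a * a' + b * b' + (a * b' + b * a') = (a + b) * (a' + b')"
      "a * a' + b * b' - (a * b' + b * a') = (a - b) * (a' - b')"
      by (simp_all add: algebra_simps)
    then have "norm (x * y) = max (cmod (a + b) * cmod (a' + b')) (cmod (a - b) * cmod (a' - b'))"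
      by (simp add: ops norm_mult)
    also have "\<dots> \<le> norm x * norm y"
      unfolding ops by (intro max.boundedI mult_mono) (auto simp: le_max_iff_disj)
    finally show ?thesis .
  qed
qed

end

instantiation kmat :: banach_star_algebra
begin

lift_definition scaleC_kmat :: "complex \<Rightarrow> kmat \<Rightarrow> kmat" is "\<lambda>z M. \<chi> i j. z * M $ i $ j"
  by (metis Tmat_ops(8))
lift_definition star_kmat :: "kmat \<Rightarrow> kmat" is "\<lambda>M. Tmat (cnj (M$1$1)) (- cnj (M$1$2))" by auto

lemma T_star_ops:
  "z *\<^sub>C T a b = T (z * a) (z * b)"
  "star (T a b) = T (cnj a) (- cnj b)"
  by (transfer, simp add: Tmat_ops)+

instance
proof
  fix x y :: kmat and r :: real and c d :: complex
  obtain a b a' b' where T: "x = T a b" "y = T a' b'"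
    by (metis T_cases)
  note ops = T T_ring_ops T_normed_ops T_star_ops
  show "r *\<^sub>R x = complex_of_real r *\<^sub>C x" "c *\<^sub>C (x + y) = c *\<^sub>C x + c *\<^sub>C y"
    "(c + d) *\<^sub>C x = c *\<^sub>C x + d *\<^sub>C x" "c *\<^sub>C d *\<^sub>C x = (c * d) *\<^sub>C x"
    "c *\<^sub>C x * y = c *\<^sub>C (x * y)" "x * c *\<^sub>C y = c *\<^sub>C (x * y)"
    "star (star x) = x" "star (x + y) = star x + star y" "star (c *\<^sub>C x) = cnj c *\<^sub>C star x"
    "star (x * y) = star y * star x"
    by (simp_all add: ops algebra_simps)
  show "norm (c *\<^sub>C x) = cmod c * norm x"
    by (simp add: ops max_mult_distrib_left norm_mult flip: distrib_left right_diff_distrib)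
next
  fix X :: "nat \<Rightarrow> kmat"
  assume "Cauchy X"
  have "\<forall>n. \<exists>a b. X n = T a b" by (metis T_cases)
  then obtain a b where X: "\<And>n. X n = T (a n) (b n)" by metis
  have dX: "dist (X m) (T s t) = max (cmod (a m + b m - (s + t))) (cmod (a m - b m - (s - t)))" for m s t
    by (simp add: dist_norm X T_ring_ops T_normed_ops algebra_simps)
  have "dist (a m + b m) (a n + b n) \<le> dist (X m) (X n)"
    "dist (a m - b m) (a n - b n) \<le> dist (X m) (X n)" for m n
    unfolding X[of n] dX by (simp_all add: dist_norm)
  then have "Cauchy (\<lambda>n. a n + b n)" "Cauchy (\<lambda>n. a n - b n)"
    using \<open>Cauchy X\<close> unfolding Cauchy_def by (meson le_less_trans)+
  then obtain s d where s: "(\<lambda>n. a n + b n) \<longlonglongrightarrow> s" and d: "(\<lambda>n. a n - b n) \<longlonglongrightarrow> d"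
    by (meson Cauchy_convergent convergent_def)
  have "(\<lambda>n. max (cmod (a n + b n - s)) (cmod (a n - b n - d))) \<longlonglongrightarrow> max 0 0"
    by (intro tendsto_max tendsto_norm_zero LIM_zero s d)
  moreover have "(s + d) / 2 + (s - d) / 2 = s" "(s + d) / 2 - (s - d) / 2 = d"
    by (simp_all add: field_simps)
  ultimately have "(\<lambda>n. dist (X n) (T ((s + d) / 2) ((s - d) / 2))) \<longlonglongrightarrow> 0"
    by (simp add: dX)
  then show "convergent X"
    using convergent_def tendsto_dist_iff by blast
qed

end

lemmas T_ops = T_ring_ops T_normed_ops T_star_ops

lift_definition K_symmetry :: "kmat \<Rightarrow> kmat" is "\<lambda>M. Tmat (M$1$1) (- (M$1$2))" by auto

lift_definition K_odd_symmetry :: "kmat \<Rightarrow> kmat" is "\<lambda>M. Tmat (M$1$2) (M$1$1)" by auto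

lemma K_symmetry_T [simp]: "K_symmetry (T a b) = T a (- b)"
  by transfer simp

lemma K_odd_symmetry_T [simp]: "K_odd_symmetry (T a b) = T b a"
  by transfer simp

lemma fundamental_symmetry_K: "fundamental_symmetry K_symmetry"
proof -
  have inv: "K_symmetry (K_symmetry x) = x" for x
    by (cases x) simp
  have "bij K_symmetry"
    by (rule o_bij[of K_symmetry]) (auto simp: inv)
  moreover have "star_hom K_symmetry"
  proof -
    have "K_symmetry (x + y) = K_symmetry x + K_symmetry y"
      "K_symmetry (x * y) = K_symmetry x * K_symmetry y"
      "K_symmetry (c *\<^sub>C x) = c *\<^sub>C K_symmetry x" "K_symmetry (star x) = star (K_symmetry x)"
      for x y c by (cases x; cases y; simp add: T_ops algebra_simps)+
    then show ?thesis by (simp add: star_hom_def complex_linear_iff)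
  qed
  moreover have "norm (K_symmetry (star x) * x) = (norm x)\<^sup>2" for x
  proof (cases x)
    case (1 a b)
    have "norm (K_symmetry (star x) * x) =
        max (cmod (cnj (a + b) * (a + b))) (cmod (cnj (a - b) * (a - b)))"
      by (simp add: 1 T_ops algebra_simps)
    also have "\<dots> = max ((cmod (a + b))\<^sup>2) ((cmod (a - b))\<^sup>2)"
      by (simp only: norm_mult complex_mod_cnj power2_eq_square)
    also have "\<dots> = (norm x)\<^sup>2"
      by (simp add: 1 T_ops max_def power2_le_iff_abs_le abs_le_square_iff[symmetric])
    finally show ?thesis .
  qed
  ultimately show ?thesis
    by (auto simp: fundamental_symmetry_def inv)
qed

lemma odd_symmetry_K: "odd_symmetry K_odd_symmetry"
proof -
  have "K_odd_symmetry (x + y) = K_odd_symmetry x + K_odd_symmetry y"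
    "K_odd_symmetry (x * y) = K_odd_symmetry x * y"
    "K_odd_symmetry (x * y) = x * K_odd_symmetry y"
    "K_odd_symmetry (c *\<^sub>C x) = c *\<^sub>C K_odd_symmetry x"
    "K_odd_symmetry (star x) = - star (K_odd_symmetry x)"
    "K_odd_symmetry (K_odd_symmetry x) = x"
    for x y c by (cases x; cases y; simp add: T_ops algebra_simps)+
  then show ?thesis
    unfolding odd_symmetry_def complex_linear_iff fun_eq_iff comp_apply id_apply by blast
qed

lemma compatible_symmetries_K: "compatible_symmetries K_symmetry K_odd_symmetry"
proof -
  have "K_odd_symmetry (K_symmetry x) = - K_symmetry (K_odd_symmetry x)" for x
    by (cases x) (simp add: T_ops)
  then show ?thesis by (simp add: compatible_symmetries_def)
qed


section \<open>The base space of the spectrum\<close>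

definition Omega :: "('a::{banach_star_algebra,monoid_mult} \<Rightarrow> 'a) \<Rightarrow> ('a \<Rightarrow> kmat) set"
  where "Omega \<alpha> = {w. unital_star_hom w \<and> w \<circ> \<alpha> = K_symmetry \<circ> w}"

definition Omega_topology ::
    "('a::{banach_star_algebra,monoid_mult} \<Rightarrow> 'a) \<Rightarrow> ('a \<Rightarrow> kmat) topology"
  where "Omega_topology \<alpha> =
    topology_generated_by {{w \<in> Omega \<alpha>. w a \<in> U} | a U. open U}"

definition Omega_rel ::
    "('a::{banach_star_algebra,monoid_mult} \<Rightarrow> 'a) \<Rightarrow> (('a \<Rightarrow> kmat) \<times> ('a \<Rightarrow> kmat)) set"
  where "Omega_rel \<alpha> = {(w\<^sub>1, w\<^sub>2). w\<^sub>1 \<in> Omega \<alpha> \<and> w\<^sub>2 \<in> Omega \<alpha> \<and>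
    (\<exists>\<phi> :: kmat \<Rightarrow> kmat. unital_star_hom \<phi> \<and> bij \<phi> \<and> w\<^sub>2 = \<phi> \<circ> w\<^sub>1)}"

definition Omega_b ::
    "('a::{banach_star_algebra,monoid_mult} \<Rightarrow> 'a) \<Rightarrow> ('a \<Rightarrow> kmat) set topology"
  where "Omega_b \<alpha> = topology (\<lambda>U. U \<subseteq> Omega \<alpha> // Omega_rel \<alpha> \<and>
    openin (Omega_topology \<alpha>) {w \<in> Omega \<alpha>. Omega_rel \<alpha> `` {w} \<in> U})"

lemma topspace_Omega_topology: "topspace (Omega_topology \<alpha>) = Omega \<alpha>"
  unfolding Omega_topology_def topology_generated_by_topspace
  by (auto intro!: exI[of _ "UNIV :: kmat set"])

lemma openin_Omega_b:
  "openin (Omega_b \<alpha>) U \<longleftrightarrow> U \<subseteq> Omega \<alpha> // Omega_rel \<alpha> \<and>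
    openin (Omega_topology \<alpha>) {w \<in> Omega \<alpha>. Omega_rel \<alpha> `` {w} \<in> U}"
proof -
  let ?P = "\<lambda>U. {w \<in> Omega \<alpha>. Omega_rel \<alpha> `` {w} \<in> U}"
  have "istopology (\<lambda>U. U \<subseteq> Omega \<alpha> // Omega_rel \<alpha> \<and> openin (Omega_topology \<alpha>) (?P U))"
    unfolding istopology_def
  proof (intro conjI allI impI)
    fix S V
    assume S: "S \<subseteq> Omega \<alpha> // Omega_rel \<alpha> \<and> openin (Omega_topology \<alpha>) (?P S)"
      and V: "V \<subseteq> Omega \<alpha> // Omega_rel \<alpha> \<and> openin (Omega_topology \<alpha>) (?P V)"
    from S show "S \<inter> V \<subseteq> Omega \<alpha> // Omega_rel \<alpha>" by blast
    have "?P (S \<inter> V) = ?P S \<inter> ?P V" by blast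
    then show "openin (Omega_topology \<alpha>) (?P (S \<inter> V))"
      using openin_Int[of "Omega_topology \<alpha>" "?P S" "?P V"] S V by argo
  next
    fix F
    assume F: "\<forall>S\<in>F. S \<subseteq> Omega \<alpha> // Omega_rel \<alpha> \<and> openin (Omega_topology \<alpha>) (?P S)"
    then show "\<Union>F \<subseteq> Omega \<alpha> // Omega_rel \<alpha>" by blast
    have eq: "?P (\<Union>F) = \<Union>(?P ` F)" by blast
    show "openin (Omega_topology \<alpha>) (?P (\<Union>F))"
      unfolding eq using F by (intro openin_Union) blast
  qed
  then show ?thesis unfolding Omega_b_def by (rule topology_inverse'[THEN fun_cong])
qed

lemma topspace_Omega_b: "topspace (Omega_b \<alpha>) = Omega \<alpha> // Omega_rel \<alpha>"
proof (rule antisym)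
  show "topspace (Omega_b \<alpha>) \<subseteq> Omega \<alpha> // Omega_rel \<alpha>"
    using openin_topspace[of "Omega_b \<alpha>"] unfolding openin_Omega_b by (rule conjunct1)
  have "{w \<in> Omega \<alpha>. Omega_rel \<alpha> `` {w} \<in> Omega \<alpha> // Omega_rel \<alpha>} = topspace (Omega_topology \<alpha>)"
    unfolding topspace_Omega_topology by (blast intro: quotientI)
  then have "openin (Omega_b \<alpha>) (Omega \<alpha> // Omega_rel \<alpha>)"
    unfolding openin_Omega_b by simp
  then show "Omega \<alpha> // Omega_rel \<alpha> \<subseteq> topspace (Omega_b \<alpha>)"
    by (rule openin_subset)
qed

lemma quotient_map_Omega_b:
  "quotient_map (Omega_topology \<alpha>) (Omega_b \<alpha>) (\<lambda>w. Omega_rel \<alpha> `` {w})"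
  unfolding quotient_map_def topspace_Omega_topology topspace_Omega_b
  by (auto simp: openin_Omega_b quotient_def)


section \<open>Gelfand transform and the algebra of K-valued continuous functions\<close>

text \<open>
  \<open>the_elem\<close> picks out the common value of the formula on all representatives of a class;
  see \<open>gelfand_class\<close> below for its independence of the representative.
\<close>

definition gelfand ::
    "('a::{banach_star_algebra,monoid_mult} \<Rightarrow> 'a) \<Rightarrow> ('a \<Rightarrow> 'a) \<Rightarrow> 'a \<Rightarrow>
      ('a \<Rightarrow> kmat) set \<Rightarrow> kmat"
  where "gelfand \<alpha> \<epsilon> x = (\<lambda>c\<in>Omega \<alpha> // Omega_rel \<alpha>.
    the_elem ((\<lambda>w. w (even_comp \<alpha> x) + K_odd_symmetry (w (\<epsilon> (odd_comp \<alpha> x)))) ` c))"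

lemma gelfand_class:
  assumes \<alpha>: "fundamental_symmetry \<alpha>" and \<epsilon>: "odd_symmetry \<epsilon>"
    and comp: "compatible_symmetries \<alpha> \<epsilon>" and w: "w \<in> Omega \<alpha>"
  shows "gelfand \<alpha> \<epsilon> x (Omega_rel \<alpha> `` {w}) =
    w (even_comp \<alpha> x) + K_odd_symmetry (w (\<epsilon> (odd_comp \<alpha> x)))"
proof -
  have fixed: "\<phi> (w p) = w p"
    if "\<alpha> p = p" "unital_star_hom \<phi>" for p and \<phi> :: "kmat \<Rightarrow> kmat"
  proof -
    have "w (\<alpha> p) = K_symmetry (w p)"
      using w by (metis (mono_tags, lifting) Omega_def comp_apply mem_Collect_eq)
    then have "K_symmetry (w p) = w p" using that by simp
    then obtain a where "w p = T a 0"
      by (cases "w p") auto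
    then have "w p = a *\<^sub>C 1" by (simp add: T_ops)
    then show ?thesis
      using that(2) by (simp add: unital_star_hom_def star_hom_def complex_linear_iff)
  qed
  have even: "\<alpha> (even_comp \<alpha> x) = even_comp \<alpha> x"
    and minus: "\<alpha> (odd_comp \<alpha> x) = - odd_comp \<alpha> x"
    using even_odd_decomposition(1)[OF \<alpha>, of x] by (auto simp: even_part_def odd_part_def)
  have odd: "\<alpha> (\<epsilon> (odd_comp \<alpha> x)) = \<epsilon> (odd_comp \<alpha> x)"
  proof -
    have "\<epsilon> (- y) = - \<epsilon> y" for y
    proof -
      have "\<epsilon> ((-1) *\<^sub>C y) = (-1) *\<^sub>C \<epsilon> y"
        using \<epsilon> unfolding odd_symmetry_def complex_linear_iff by blast
      then show ?thesis by (simp add: complex_vector.scale_minus_left scaleC_one)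
    qed
    then show ?thesis
      using comp minus
      by (metis compatible_symmetries_def minus_minus)
  qed
  have const: "v (even_comp \<alpha> x) + K_odd_symmetry (v (\<epsilon> (odd_comp \<alpha> x))) =
      w (even_comp \<alpha> x) + K_odd_symmetry (w (\<epsilon> (odd_comp \<alpha> x)))"
    if v: "v \<in> Omega_rel \<alpha> `` {w}" for v
  proof -
    obtain \<phi> :: "kmat \<Rightarrow> kmat" where \<phi>: "unital_star_hom \<phi>" "v = \<phi> \<circ> w"
      using v unfolding Omega_rel_def by blast
    show ?thesis
      by (simp only: \<phi>(2) comp_apply fixed[OF even \<phi>(1)] fixed[OF odd \<phi>(1)])
  qed
  have "unital_star_hom (id :: kmat \<Rightarrow> kmat)"
    by (simp add: unital_star_hom_def star_hom_def complex_linear_iff)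
  then have "w \<in> Omega_rel \<alpha> `` {w}"
    using w by (auto simp: Omega_rel_def intro!: exI[of _ id])
  then have "(\<lambda>w. w (even_comp \<alpha> x) + K_odd_symmetry (w (\<epsilon> (odd_comp \<alpha> x)))) `
      (Omega_rel \<alpha> `` {w}) = {w (even_comp \<alpha> x) + K_odd_symmetry (w (\<epsilon> (odd_comp \<alpha> x)))}"
    using const by blast
  then show ?thesis
    using w by (simp add: gelfand_def quotientI)
qed

text \<open>
  Elements of \<open>CK M\<close> are extensional (\<open>undefined\<close> off \<open>topspace M\<close>), so that equality of
  functions is equality on \<open>M\<close>.
\<close>

definition CK :: "'m topology \<Rightarrow> ('m \<Rightarrow> kmat) set"
  where "CK M = {f. continuous_map M euclidean f \<and> f \<in> extensional (topspace M)}"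

text \<open>The inserted \<open>0\<close> only matters for empty \<open>M\<close>, where it makes the supremum \<open>0\<close>.\<close>

definition CK_norm :: "'m topology \<Rightarrow> ('m \<Rightarrow> kmat) \<Rightarrow> real"
  where "CK_norm M f = Sup (insert 0 ((\<lambda>m. norm (f m)) ` topspace M))"

definition isometric_star_iso_CK ::
    "'m topology \<Rightarrow> ('a::banach_star_algebra \<Rightarrow> 'm \<Rightarrow> kmat) \<Rightarrow> bool"
  where "isometric_star_iso_CK M \<phi> \<longleftrightarrow>
    bij_betw \<phi> UNIV (CK M) \<and>
    (\<forall>x y. \<phi> (x + y) = (\<lambda>m\<in>topspace M. \<phi> x m + \<phi> y m)) \<and>
    (\<forall>c x. \<phi> (c *\<^sub>C x) = (\<lambda>m\<in>topspace M. c *\<^sub>C \<phi> x m)) \<and>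
    (\<forall>x y. \<phi> (x * y) = (\<lambda>m\<in>topspace M. \<phi> x m * \<phi> y m)) \<and>
    (\<forall>x. \<phi> (star x) = (\<lambda>m\<in>topspace M. star (\<phi> x m))) \<and>
    (\<forall>x. CK_norm M (\<phi> x) = norm x)"

end

theory Submission
  imports Defs
begin

text \<open>
  The norm of \<open>A\<close> and the involution \<open>x \<mapsto> \<alpha>(x)\<^sup>*\<close> make \<open>A\<close> a commutative C*-algebra, so \<open>A\<close> is the
  algebra of all continuous functions on its compact space of characters.  A character \<open>\<xi>\<close> yields
  the point \<open>x \<mapsto> T (\<xi>(x\<^sub>+)) (\<xi>(x\<^sub>-))\<close> of \<open>\<Omega>(A,\<alpha>)\<close>, every point arises in this way, and \<open>\<xi>\<close>, \<open>\<xi> \<circ> \<alpha>\<close>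
  give equivalent points.  Put \<open>e = \<epsilon>(1)\<close>; then \<open>\<epsilon>\<close> is multiplication by \<open>e\<close>, \<open>\<alpha>(e) = -e\<close>, \<open>e\<^sup>2 = 1\<close> and
  \<open>\<xi>(e) = \<plusminus>1\<close>.  Hence the Gelfand transform of \<open>x\<close> at \<open>[\<xi>]\<close> is \<open>T (\<xi>(x\<^sub>+)) (\<xi>(e x\<^sub>-))\<close>, a matrix of norm
  \<open>max \<bar>\<xi>(x)\<bar> \<bar>\<xi>(\<alpha>(x))\<bar>\<close>.

  Characters attaining the norm are found without spectral theory: \<open>1 - h\<close> is a square whenever
  \<open>h\<close> is selfadjoint of norm at most \<open>1\<close>, so every maximal proper preorder on the selfadjoint elements
  is total and archimedean and determines a character.  Surjectivity is the Stone-Weierstrass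
  theorem.
\<close>

section \<open>Square roots in unital Banach algebras\<close>

text \<open>After the constant term \<open>1\<close>, all coefficients of the series of
  \<open>sqrt (1 - z)\<close> are nonpositive, and its partial sums at \<open>z = 1\<close> equal
  \<open>pochhammer (1/2) n / fact n\<close>, which is nonnegative. Hence the absolute values of the
  remaining coefficients sum to at most \<open>1\<close>.\<close>

lemma summable_gbinomial_half: "summable (\<lambda>k. \<bar>(1/2 :: real) gchoose k\<bar>)"
proof -
  let ?c = "\<lambda>k. ((1/2 :: real) gchoose k) * (-1) ^ k"
  have sgn: "?c (Suc k) \<le> 0" for k
  proof -
    have "?c (Suc k) = pochhammer (- (1/2)) (Suc k) / fact (Suc k)"
      by (simp add: gbinomial_pochhammer flip: power_mult_distrib)
    also have "pochhammer (- (1/2) :: real) (Suc k) \<le> 0"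
      using pochhammer_nonneg[of "1/2 :: real" k] by (simp add: pochhammer_rec)
    then have "pochhammer (- (1/2) :: real) (Suc k) / fact (Suc k) \<le> 0"
      by (intro divide_nonpos_nonneg) auto
    finally show ?thesis .
  qed
  have "(\<Sum>k<n. \<bar>(1/2 :: real) gchoose Suc k\<bar>) \<le> 1" for n
  proof -
    have "(\<Sum>k<n. \<bar>(1/2 :: real) gchoose Suc k\<bar>) = (\<Sum>k<n. - ?c (Suc k))"
    proof (intro sum.cong refl)
      fix k
      have "\<bar>(1/2 :: real) gchoose Suc k\<bar> = \<bar>?c (Suc k)\<bar>"
        by (simp add: abs_mult power_abs)
      then show "\<bar>(1/2 :: real) gchoose Suc k\<bar> = - ?c (Suc k)"
        using sgn[of k] by linarith
    qed
    also have "\<dots> = 1 - (\<Sum>k\<le>n. ?c k)"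
      by (simp add: sum_negf sum.atMost_shift)
    also have "(\<Sum>k\<le>n. ?c k) = pochhammer (1/2) n / fact n"
      unfolding gbinomial_sum_lower_neg by (simp add: gbinomial_pochhammer flip: power_mult_distrib)
    finally show ?thesis
      using pochhammer_nonneg[of "1/2 :: real" n] by simp
  qed
  then have "summable (\<lambda>k. \<bar>(1/2 :: real) gchoose Suc k\<bar>)"
    by (intro summableI_nonneg_bounded[where x=1]) auto
  then show ?thesis
    by (subst (asm) summable_Suc_iff)
qed

text \<open>The binomial series with exponent \<open>1/2\<close> converges absolutely even on the
  boundary \<open>norm z = 1\<close>. Its Cauchy square has coefficients \<open>1 gchoose k\<close>
  up to sign by Vandermonde, and these vanish for \<open>k > 1\<close>.\<close>

lemma sqrt_one_minus_series:
  fixes z :: "'a::{real_normed_algebra,banach,monoid_mult}"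
  assumes "norm z \<le> 1"
  defines "t \<equiv> \<lambda>k. (((1/2 :: real) gchoose k) * (-1) ^ k) *\<^sub>R z ^ k"
  shows "summable t" "suminf t * suminf t = 1 - z"
proof -
  \<comment> \<open>The sort does not normalise the norm of the unit, so the exponent
    \<open>0\<close> requires the summand \<open>norm 1\<close>.\<close>
  have bound: "norm (z ^ k) \<le> 1 + norm (1 :: 'a)" for k
  proof -
    have "norm (z ^ Suc k) \<le> 1" for k
    proof (induction k)
      case (Suc k)
      have "norm (z ^ Suc (Suc k)) \<le> norm z * norm (z ^ Suc k)"
        using norm_mult_ineq[of z "z ^ Suc k"] by simp
      also have "\<dots> \<le> 1 * 1"
        using Suc assms(1) by (intro mult_mono) auto
      finally show ?case by simp
    qed (use assms in simp)
    then show ?thesis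
      by (cases k) (auto intro: add_increasing2)
  qed
  have "norm (t k) \<le> \<bar>(1/2 :: real) gchoose k\<bar> * (1 + norm (1 :: 'a))" for k
    using bound[of k] by (simp add: t_def abs_mult power_abs mult_left_mono)
  then have summ: "summable (\<lambda>k. norm (t k))"
    by (intro summable_comparison_test[OF _ summable_mult2[OF summable_gbinomial_half]] exI[of _ 0])
      auto
  then show "summable t"
    by (rule summable_norm_cancel)
  have coeff: "(\<Sum>i\<le>k. t i * t (k - i)) = (((1 :: real) gchoose k) * (-1) ^ k) *\<^sub>R z ^ k" for k
  proof -
    have "(\<Sum>i\<le>k. t i * t (k - i)) =
        (\<Sum>i\<le>k. ((((1/2 :: real) gchoose i) * ((1/2) gchoose (k - i))) * (-1) ^ k) *\<^sub>R z ^ k)"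
    proof (intro sum.cong refl)
      fix i assume "i \<in> {..k}"
      then obtain j where "k = i + j" by (auto simp: le_iff_add)
      then show "t i * t (k - i) =
          ((((1/2 :: real) gchoose i) * ((1/2) gchoose (k - i))) * (-1) ^ k) *\<^sub>R z ^ k"
        by (simp add: t_def power_add mult_ac)
    qed
    also have "\<dots> = ((\<Sum>i\<le>k. ((1/2 :: real) gchoose i) * ((1/2) gchoose (k - i))) * (-1) ^ k) *\<^sub>R z ^ k"
      by (simp add: scaleR_sum_left sum_distrib_right)
    finally show ?thesis
      using gbinomial_Vandermonde[of "1/2 :: real" "1/2" k] by (simp add: atMost_atLeast0)
  qed
  have "(\<lambda>k. (((1 :: real) gchoose k) * (-1) ^ k) *\<^sub>R z ^ k) sums
      (\<Sum>k\<in>{0,1}. (((1 :: real) gchoose k) * (-1) ^ k) *\<^sub>R z ^ k)"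
  proof (rule sums_finite)
    fix k :: nat assume "k \<notin> {0,1}"
    then have "(1 :: nat) choose k = 0" by simp
    then have "(1 :: real) gchoose k = 0" by (metis binomial_gbinomial of_nat_0 of_nat_1)
    then show "(((1 :: real) gchoose k) * (-1) ^ k) *\<^sub>R z ^ k = 0" by simp
  qed simp
  then show "suminf t * suminf t = 1 - z"
    using Cauchy_product_sums[OF summ summ] sums_unique2 by (fastforce simp: coeff)
qed

section \<open>Separation axioms for function spaces\<close>

instance "fun" :: (type, t0_space) t0_space
proof
  fix f g :: "'a \<Rightarrow> 'b"
  assume "f \<noteq> g"
  then obtain i where "f i \<noteq> g i" by auto
  then obtain U where U: "open U" "\<not> (f i \<in> U \<longleftrightarrow> g i \<in> U)"
    using separation_t0[of "f i" "g i"] by auto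
  have "open ((\<lambda>h. h i) -` U)"
    using U(1) by (auto intro!: open_vimage)
  then show "\<exists>U. open U \<and> \<not> (f \<in> U \<longleftrightarrow> g \<in> U)"
    using U(2) by (intro exI[of _ "(\<lambda>h. h i) -` U"]) auto
qed

instance "fun" :: (type, t1_space) t1_space
proof
  fix f g :: "'a \<Rightarrow> 'b"
  assume "f \<noteq> g"
  then obtain i where "f i \<noteq> g i" by auto
  then obtain U where U: "open U" "f i \<in> U" "g i \<notin> U"
    using t1_space[of "f i" "g i"] by auto
  have "open ((\<lambda>h. h i) -` U)"
    using U(1) by (auto intro!: open_vimage)
  then show "\<exists>U. open U \<and> f \<in> U \<and> g \<notin> U"
    using U(2,3) by (intro exI[of _ "(\<lambda>h. h i) -` U"]) auto
qed

text \<open>Distinct functions differ at some coordinate, and coordinate projections are continuous.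
  The locale \<open>function_ring_on\<close> asks for a Hausdorff domain; here the domain type is
  \<open>'a \<Rightarrow> complex\<close>, which carries the characters.\<close>

instance "fun" :: (type, t2_space) t2_space
proof
  fix f g :: "'a \<Rightarrow> 'b"
  assume "f \<noteq> g"
  then obtain i where "f i \<noteq> g i" by auto
  then obtain U V where UV: "open U" "open V" "f i \<in> U" "g i \<in> V" "U \<inter> V = {}"
    using hausdorff[of "f i" "g i"] by auto
  then have "open ((\<lambda>h. h i) -` U)" "open ((\<lambda>h. h i) -` V)"
    by (auto intro!: open_vimage)
  then show "\<exists>U V. open U \<and> open V \<and> f \<in> U \<and> g \<in> V \<and> U \<inter> V = {}"
    using UV(3-5) by (intro exI[of _ "(\<lambda>h. h i) -` U"] exI[of _ "(\<lambda>h. h i) -` V"]) auto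
qed

section \<open>Commutative C*-algebras\<close>

text \<open>The adjoint is a parameter separate from \<open>star\<close>, because in a Krein
  C*-algebra the C*-identity holds for \<open>dagger \<alpha>\<close>.\<close>

locale commutative_cstar =
  fixes adj :: "'a::{banach_star_algebra,comm_monoid_mult} \<Rightarrow> 'a"
  assumes adj_add: "adj (x + y) = adj x + adj y"
    and adj_scaleC: "adj (c *\<^sub>C x) = cnj c *\<^sub>C adj x"
    and adj_mult: "adj (x * y) = adj x * adj y"
    and adj_adj [simp]: "adj (adj x) = x"
    and norm_adj_mult: "norm (adj x * x) = (norm x)\<^sup>2"
begin

lemma adj_scaleR: "adj (r *\<^sub>R x) = r *\<^sub>R adj x"
  by (simp add: scaleR_scaleC adj_scaleC)

lemma adj_minus: "adj (- x) = - adj x"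
  using adj_scaleR[of "-1" x] by simp

lemma adj_diff: "adj (x - y) = adj x - adj y"
  using adj_add[of x "- y"] by (simp add: adj_minus)

lemma adj_0 [simp]: "adj 0 = 0"
  using adj_diff[of 0 0] by simp

lemma adj_1 [simp]: "adj 1 = 1"
proof -
  have "adj (adj 1 * 1) = adj (adj 1) * adj 1"
    by (rule adj_mult)
  then show ?thesis by simp
qed

lemmas adj_simps = adj_add adj_diff adj_minus adj_scaleR adj_scaleC adj_mult

lemma norm_adj [simp]: "norm (adj x) = norm x"
proof -
  have "norm y \<le> norm (adj y)" for y
  proof (cases "y = 0")
    case False
    have "norm y * norm y \<le> norm (adj y) * norm y"
      using norm_mult_ineq[of "adj y" y] by (simp add: norm_adj_mult power2_eq_square)
    then show ?thesis using False by simp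
  qed simp
  from this[of x] this[of "adj x"] show ?thesis by simp
qed

lemma norm_1_le: "norm (1 :: 'a) \<le> 1"
proof -
  have "(norm (1 :: 'a))\<^sup>2 = norm (1 :: 'a)"
    using norm_adj_mult[of 1] by simp
  then show ?thesis by (auto simp: power2_eq_square)
qed

lemma bounded_linear_adj: "bounded_linear adj"
  by (rule bounded_linear_intro[of _ 1]) (simp_all add: adj_simps)

section \<open>Selfadjoint elements, real and imaginary parts, and square roots\<close>

definition selfadjoint :: "'a set"
  where "selfadjoint = {x. adj x = x}"

definition re :: "'a \<Rightarrow> 'a"
  where "re x = (1/2) *\<^sub>R (x + adj x)"

text \<open>The usual \<open>(x - adj x) / (2 i)\<close>, with division by \<open>i\<close> written
  as multiplication by \<open>- i\<close>.\<close>

definition im :: "'a \<Rightarrow> 'a"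
  where "im x = (1/2) *\<^sub>R (\<i> *\<^sub>C (adj x - x))"

lemma selfadjoint_closed:
  "1 \<in> selfadjoint" "0 \<in> selfadjoint"
  "x \<in> selfadjoint \<Longrightarrow> y \<in> selfadjoint \<Longrightarrow> x + y \<in> selfadjoint"
  "x \<in> selfadjoint \<Longrightarrow> y \<in> selfadjoint \<Longrightarrow> x - y \<in> selfadjoint"
  "x \<in> selfadjoint \<Longrightarrow> y \<in> selfadjoint \<Longrightarrow> x * y \<in> selfadjoint"
  "x \<in> selfadjoint \<Longrightarrow> - x \<in> selfadjoint"
  "x \<in> selfadjoint \<Longrightarrow> r *\<^sub>R x \<in> selfadjoint"
  "re z \<in> selfadjoint" "im z \<in> selfadjoint"
  by (auto simp: selfadjoint_def adj_simps re_def im_def add.commute complex_vector.scale_right_diff_distrib)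

lemma re_im: "x = re x + \<i> *\<^sub>C im x"
proof -
  have "\<i> *\<^sub>C im x = (1/2) *\<^sub>R (x - adj x)"
    by (simp add: im_def scaleR_scaleC complex_vector.scale_right_diff_distrib scaleC_one
        complex_vector.scale_minus_left)
  then have "re x + \<i> *\<^sub>C im x = (1/2) *\<^sub>R x + (1/2) *\<^sub>R x"
    by (simp add: re_def algebra_simps)
  then show ?thesis
    by (simp flip: scaleR_add_left)
qed

lemma re_im_unique:
  assumes "a \<in> selfadjoint" "b \<in> selfadjoint"
  shows "re (a + \<i> *\<^sub>C b) = a" "im (a + \<i> *\<^sub>C b) = b"
  using assms
  by (auto simp: re_def im_def selfadjoint_def adj_simps scaleR_scaleC
      complex_vector.scale_right_diff_distrib complex_vector.scale_right_distrib
      complex_vector.scale_minus_left scaleC_one simp flip: scaleC_add_left)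

text \<open>After scaling by \<open>1/r\<close> the binomial series applies. Its coefficients are
  real and \<open>adj\<close> is continuous, so the root is selfadjoint. For \<open>r = 0\<close>
  the bound forces \<open>h = 0\<close>.\<close>

lemma sqrt_exists:
  assumes h: "h \<in> selfadjoint" "norm h \<le> r"
  obtains a where "a \<in> selfadjoint" "a * a = r *\<^sub>R 1 - h"
proof (cases "r = 0")
  case True
  then show ?thesis using that[of 0] h by (simp add: selfadjoint_closed)
next
  case False
  moreover have "0 \<le> r" using h(2) norm_ge_zero order_trans by blast
  ultimately have r: "0 < r" by simp
  define z where "z = (1/r) *\<^sub>R h"
  define t where "t = (\<lambda>k. (((1/2 :: real) gchoose k) * (-1) ^ k) *\<^sub>R z ^ k)"
  have "norm z \<le> 1" using h(2) r by (simp add: z_def)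
  note t = sqrt_one_minus_series[OF this, folded t_def]
  have z: "adj z = z" using h(1) by (simp add: z_def adj_simps selfadjoint_def)
  have "adj (z ^ k) = z ^ k" for k
    by (induction k) (simp_all add: adj_simps z)
  then have "adj (t k) = t k" for k
    by (simp add: t_def adj_simps)
  then have "adj (suminf t) = suminf t"
    using bounded_linear.suminf[OF bounded_linear_adj t(1)] by simp
  then have "sqrt r *\<^sub>R suminf t \<in> selfadjoint"
    by (simp add: selfadjoint_def adj_simps)
  moreover have "(sqrt r *\<^sub>R suminf t) * (sqrt r *\<^sub>R suminf t) = r *\<^sub>R 1 - h"
    using r by (simp add: t(2) z_def algebra_simps)
  ultimately show ?thesis by (rule that)
qed

text \<open>If \<open>a\<^sup>2 + b\<^sup>2 = r\<close>, then \<open>a\<close> is the real part of \<open>a + i b\<close>, a multiple of a unitary.\<close>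

lemma norm_square_le:
  assumes a: "a \<in> selfadjoint" and b: "b \<in> selfadjoint"
    and eq: "a * a + b * b = r *\<^sub>R 1" and r: "0 \<le> r"
  shows "norm (a * a) \<le> r"
proof -
  define u where "u = a + \<i> *\<^sub>C b"
  have adj_u: "adj u = a - \<i> *\<^sub>C b"
    using a b by (simp add: u_def adj_simps selfadjoint_def)
  have "adj u * u = a * a + b * b"
    unfolding adj_u by (simp add: u_def algebra_simps mult_scaleC_left mult_scaleC_right scaleC_one)
  then have "(norm u)\<^sup>2 = norm (r *\<^sub>R (1 :: 'a))"
    by (metis eq norm_adj_mult)
  also have "\<dots> \<le> r"
    using norm_1_le r by (simp add: mult_left_le)
  finally have u: "(norm u)\<^sup>2 \<le> r" .
  have "a = re u" by (simp add: u_def re_im_unique a b)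
  then have "norm a \<le> (1/2) * (norm u + norm (adj u))"
    unfolding re_def by (metis norm_scaleR norm_triangle_ineq abs_of_nonneg mult_left_mono zero_le_divide_1_iff zero_le_numeral)
  then have "norm a \<le> norm u" by simp
  then have "norm (a * a) \<le> (norm u)\<^sup>2"
    using norm_adj_mult[of a] a by (simp add: selfadjoint_def power_mono)
  with u show ?thesis by linarith
qed

section \<open>The cone of squares and the preorders above it\<close>

definition squares :: "'a set"
  where "squares = {a * a | a. a \<in> selfadjoint}"

text \<open>A square \<open>x\<close> satisfies \<open>norm (norm x - x) \<le> norm x\<close>: its
  complement \<open>norm x - x\<close> is itself a square, so \<open>norm_square_le\<close> applies.
  By the triangle inequality this estimate passes to \<open>x + y\<close>, and
  \<open>sqrt_exists\<close> then recovers a root of the sum.\<close>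

lemma squares_add:
  assumes "x \<in> squares" "y \<in> squares"
  shows "x + y \<in> squares"
proof -
  have "norm (norm x *\<^sub>R 1 - x) \<le> norm x" if x: "x \<in> squares" for x
  proof -
    obtain a where a: "a \<in> selfadjoint" "x = a * a"
      using x by (auto simp: squares_def)
    have "x \<in> selfadjoint"
      by (simp add: a selfadjoint_closed)
    then obtain b where b: "b \<in> selfadjoint" "b * b = norm x *\<^sub>R 1 - x"
      using sqrt_exists by blast
    show ?thesis
      using norm_square_le[OF b(1) a(1), of "norm x"] by (simp add: b(2) flip: a(2))
  qed
  from add_mono[OF this[OF assms(1)] this[OF assms(2)]]
  have "norm ((norm x + norm y) *\<^sub>R 1 - (x + y)) \<le> norm x + norm y"
    using norm_triangle_ineq[of "norm x *\<^sub>R 1 - x" "norm y *\<^sub>R 1 - y"]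
    by (simp add: algebra_simps)
  moreover have "(norm x + norm y) *\<^sub>R 1 - (x + y) \<in> selfadjoint"
    using assms by (auto simp: squares_def selfadjoint_closed)
  ultimately obtain a where "a \<in> selfadjoint"
    "a * a = (norm x + norm y) *\<^sub>R 1 - ((norm x + norm y) *\<^sub>R 1 - (x + y))"
    using sqrt_exists by blast
  then show ?thesis
    unfolding squares_def by (auto intro!: exI[of _ a])
qed

text \<open>A preordering in the sense of real algebra. Properness, \<open>-1 \<notin> Q\<close>, is
  stated separately, since adjoining an element may destroy it.\<close>

definition preorder_cone :: "'a set \<Rightarrow> bool"
  where "preorder_cone Q \<longleftrightarrow> Q \<subseteq> selfadjoint \<and> squares \<subseteq> Q \<and>
    (\<forall>x\<in>Q. \<forall>y\<in>Q. x + y \<in> Q \<and> x * y \<in> Q)"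

lemma preorder_coneD:
  assumes "preorder_cone Q"
  shows "x \<in> Q \<Longrightarrow> x \<in> selfadjoint" "a \<in> selfadjoint \<Longrightarrow> a * a \<in> Q"
    "x \<in> Q \<Longrightarrow> y \<in> Q \<Longrightarrow> x + y \<in> Q" "x \<in> Q \<Longrightarrow> y \<in> Q \<Longrightarrow> x * y \<in> Q"
  using assms by (auto simp: preorder_cone_def squares_def)

lemma preorder_cone_scaleR_1:
  assumes "preorder_cone Q" "0 \<le> r"
  shows "r *\<^sub>R 1 \<in> Q"
  using preorder_coneD(2)[OF assms(1), of "sqrt r *\<^sub>R 1"] assms(2) by (simp add: selfadjoint_closed)

lemma preorder_cone_scaleR:
  assumes "preorder_cone Q" "0 \<le> r" "x \<in> Q"
  shows "r *\<^sub>R x \<in> Q"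
  using preorder_coneD(4)[OF assms(1) preorder_cone_scaleR_1[OF assms(1,2)] assms(3)] by simp

text \<open>Every preorder is archimedean, with the norm as bound, because \<open>r - h\<close> is
  already a square.\<close>

lemma preorder_cone_norm:
  assumes "preorder_cone Q" "h \<in> selfadjoint" "norm h \<le> r"
  shows "r *\<^sub>R 1 - h \<in> Q"
  by (metis assms preorder_coneD(2) sqrt_exists)

lemma preorder_cone_squares: "preorder_cone squares"
proof -
  have "\<exists>c. a * a * (b * b) = c * c \<and> c \<in> selfadjoint" if "a \<in> selfadjoint" "b \<in> selfadjoint" for a b
    using that by (intro exI[of _ "a * b"]) (simp add: selfadjoint_closed mult_ac)
  then show ?thesis
    unfolding preorder_cone_def using squares_add
    by (auto simp: squares_def selfadjoint_closed)
qed

text \<open>This is the preorder generated by \<open>Q\<close> and \<open>h\<close>: in a product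
  the term with \<open>h * h\<close> falls back into \<open>Q\<close>, so expressions linear in
  \<open>h\<close> suffice.\<close>

lemma preorder_cone_extend:
  assumes Q: "preorder_cone Q" and h: "h \<in> selfadjoint"
  shows "preorder_cone {p + h * q | p q. p \<in> Q \<and> q \<in> Q}" (is "preorder_cone ?E")
    and "Q \<subseteq> {p + h * q | p q. p \<in> Q \<and> q \<in> Q}" "h \<in> {p + h * q | p q. p \<in> Q \<and> q \<in> Q}"
proof -
  have 0: "0 \<in> Q" and 1: "1 \<in> Q"
    using preorder_cone_scaleR_1[OF Q, of 0] preorder_cone_scaleR_1[OF Q, of 1] by simp_all
  have "\<exists>p' q'. p = p' + h * q' \<and> p' \<in> Q \<and> q' \<in> Q" if "p \<in> Q" for p
    using that 0 by (intro exI[of _ p] exI[of _ 0]) simp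
  then show *: "Q \<subseteq> ?E" by blast
  have "\<exists>p' q'. h = p' + h * q' \<and> p' \<in> Q \<and> q' \<in> Q"
    using 0 1 by (intro exI[of _ 0] exI[of _ 1]) simp
  then show "h \<in> ?E" by blast
  have add: "x + y \<in> ?E" and mult: "x * y \<in> ?E" if xy_in: "x \<in> ?E" "y \<in> ?E" for x y
  proof -
    obtain p q p' q' where xy: "x = p + h * q" "y = p' + h * q'" and Q': "p \<in> Q" "q \<in> Q" "p' \<in> Q" "q' \<in> Q"
      using xy_in by blast
    have "x + y = (p + p') + h * (q + q')" by (simp add: xy algebra_simps)
    then show "x + y \<in> ?E" using Q' preorder_coneD[OF Q] by blast
    have "x * y = (p * p' + (h * h) * (q * q')) + h * (p * q' + p' * q)"
      by (simp add: xy algebra_simps)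
    moreover have "p * p' + (h * h) * (q * q') \<in> Q" "p * q' + p' * q \<in> Q"
      using Q' h preorder_coneD[OF Q] by simp_all
    ultimately show "x * y \<in> ?E" by blast
  qed
  moreover have "?E \<subseteq> selfadjoint"
    by (auto intro!: selfadjoint_closed(3,5) h dest: preorder_coneD(1)[OF Q])
  moreover have "squares \<subseteq> ?E"
    using Q * unfolding preorder_cone_def by (meson order_trans)
  ultimately show "preorder_cone ?E"
    unfolding preorder_cone_def by (intro conjI ballI)
qed

text \<open>If neither \<open>h\<close> nor \<open>-h\<close> could be added to a maximal \<open>Q\<close>, multiplying \<open>-1 = p + h q\<close> with
  \<open>-1 = p' - h q'\<close> would give \<open>-1 \<in> Q\<close>.\<close>

lemma total_preorder_exists:
  assumes Q0: "preorder_cone Q0" "-1 \<notin> Q0"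
  obtains Q where "preorder_cone Q" "-1 \<notin> Q" "Q0 \<subseteq> Q"
    "\<And>h. h \<in> selfadjoint \<Longrightarrow> h \<in> Q \<or> - h \<in> Q"
proof -
  define F where "F = {Q. preorder_cone Q \<and> -1 \<notin> Q \<and> Q0 \<subseteq> Q}"
  have "\<exists>M\<in>F. \<forall>X\<in>F. M \<subseteq> X \<longrightarrow> X = M"
  proof (rule subset_Zorn_nonempty)
    show "F \<noteq> {}" using Q0 by (auto simp: F_def)
    fix C assume C: "C \<noteq> {}" "subset.chain F C"
    have chain: "\<exists>Z\<in>C. x \<in> Z \<and> y \<in> Z" if xy: "x \<in> \<Union>C" "y \<in> \<Union>C" for x y
    proof -
      obtain X Y where XY: "X \<in> C" "Y \<in> C" "x \<in> X" "y \<in> Y" using xy by blast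
      then have "X \<subseteq> Y \<or> Y \<subseteq> X" using C(2) by (auto simp: subset_chain_def)
      then show ?thesis using XY by blast
    qed
    have CF: "preorder_cone X" "-1 \<notin> X" "Q0 \<subseteq> X" if "X \<in> C" for X
      using that C(2) by (auto simp: subset_chain_def F_def)
    have "x + y \<in> \<Union>C \<and> x * y \<in> \<Union>C" if "x \<in> \<Union>C" "y \<in> \<Union>C" for x y
      using chain[OF that] CF(1) preorder_coneD by blast
    moreover have "\<Union>C \<subseteq> selfadjoint" "squares \<subseteq> \<Union>C"
      using C(1) CF(1) unfolding preorder_cone_def by blast+
    ultimately have "preorder_cone (\<Union>C)"
      unfolding preorder_cone_def by blast
    then show "\<Union>C \<in> F"
      using C(1) CF(2,3) by (auto simp: F_def)
  qed
  then obtain Q where QF: "Q \<in> F" and max: "\<And>X. X \<in> F \<Longrightarrow> Q \<subseteq> X \<Longrightarrow> X = Q"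
    by blast
  have Q: "preorder_cone Q" "-1 \<notin> Q" "Q0 \<subseteq> Q"
    using QF by (auto simp: F_def)
  have ext: "\<exists>p\<in>Q. \<exists>q\<in>Q. -1 = p + h * q" if h: "h \<in> selfadjoint" "h \<notin> Q" for h
  proof (rule ccontr)
    let ?E = "{p + h * q | p q. p \<in> Q \<and> q \<in> Q}"
    note E = preorder_cone_extend[OF Q(1) h(1)]
    assume "\<not> (\<exists>p\<in>Q. \<exists>q\<in>Q. -1 = p + h * q)"
    then have "-1 \<notin> ?E" by blast
    then have "?E \<in> F" using E(1,2) Q(3) unfolding F_def by blast
    then show False using max E(2,3) h(2) by blast
  qed
  have "h \<in> Q \<or> - h \<in> Q" if h: "h \<in> selfadjoint" for h
  proof (rule ccontr)
    assume *: "\<not> (h \<in> Q \<or> - h \<in> Q)"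
    then obtain p q where pq: "p \<in> Q" "q \<in> Q" "-1 = p + h * q"
      using ext h by blast
    obtain p' q' where pq': "p' \<in> Q" "q' \<in> Q" "-1 = p' + (- h) * q'"
      using ext[OF selfadjoint_closed(6)[OF h]] * by blast
    have "h * q = (p + h * q) - p" "h * q' = p' - (p' + (- h) * q')"
      by simp_all
    then have "h * q = - 1 - p" "h * q' = 1 + p'"
      unfolding pq(3)[symmetric] pq'(3)[symmetric] by simp_all
    then have "(h * q) * (h * q') = (- 1 - p) * (1 + p')"
      by (simp only:)
    then have "-1 = p + p' + p * p' + (h * h) * (q * q')"
      by (simp add: algebra_simps)
    moreover have "p + p' + p * p' + (h * h) * (q * q') \<in> Q"
      using pq pq' h preorder_coneD[OF Q(1)] by simp
    ultimately show False using Q(2) by argo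
  qed
  then show ?thesis using that Q by blast
qed

text \<open>These rules reduce the laws of a complex character to real laws on selfadjoint elements.
  The formulas for products and scalars follow by exhibiting a decomposition and invoking its
  uniqueness.\<close>

lemma re_im_simps:
  "re (x + y) = re x + re y" "im (x + y) = im x + im y"
  "re (x * y) = re x * re y - im x * im y" "im (x * y) = re x * im y + im x * re y"
  "re (c *\<^sub>C x) = Re c *\<^sub>R re x - Im c *\<^sub>R im x" "im (c *\<^sub>C x) = Re c *\<^sub>R im x + Im c *\<^sub>R re x"
  "re (adj x) = re x" "im (adj x) = - im x"
proof -
  show "re (x + y) = re x + re y" "im (x + y) = im x + im y"
    "re (adj x) = re x" "im (adj x) = - im x"
    by (simp_all add: re_def im_def adj_simps algebra_simps complex_vector.scale_right_diff_distrib scaleC_add_right)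
  have "(re x + \<i> *\<^sub>C im x) * (re y + \<i> *\<^sub>C im y) =
      (re x * re y - im x * im y) + \<i> *\<^sub>C (re x * im y + im x * re y)"
    by (simp add: distrib_left distrib_right mult_scaleC_left mult_scaleC_right scaleC_scaleC
        scaleC_add_right scaleC_one add_ac)
  then have "x * y = (re x * re y - im x * im y) + \<i> *\<^sub>C (re x * im y + im x * re y)"
    by (simp flip: re_im)
  then show "re (x * y) = re x * re y - im x * im y" "im (x * y) = re x * im y + im x * re y"
    using re_im_unique by (simp_all add: selfadjoint_closed)
  have "c *\<^sub>C u = Re c *\<^sub>R u + \<i> *\<^sub>C (Im c *\<^sub>R u)" for u :: 'a
    by (simp add: scaleR_scaleC scaleC_scaleC complex_eq flip: scaleC_add_left)
  note split = this
  have "c *\<^sub>C (re x + \<i> *\<^sub>C im x) = c *\<^sub>C re x + \<i> *\<^sub>C (c *\<^sub>C im x)"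
    by (simp add: scaleC_add_right scaleC_scaleC mult.commute)
  also have "\<dots> = Re c *\<^sub>R re x + \<i> *\<^sub>C (Im c *\<^sub>R re x) +
      (\<i> *\<^sub>C (Re c *\<^sub>R im x) - Im c *\<^sub>R im x)"
    unfolding split[of "re x"] split[of "im x"]
    by (simp add: scaleC_add_right scaleC_scaleC scaleR_scaleC complex_vector.scale_minus_left)
  also have "\<dots> = (Re c *\<^sub>R re x - Im c *\<^sub>R im x) +
      \<i> *\<^sub>C (Re c *\<^sub>R im x + Im c *\<^sub>R re x)"
    by (simp add: scaleC_add_right algebra_simps)
  finally have "c *\<^sub>C (re x + \<i> *\<^sub>C im x) =
      (Re c *\<^sub>R re x - Im c *\<^sub>R im x) + \<i> *\<^sub>C (Re c *\<^sub>R im x + Im c *\<^sub>R re x)" .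
  then have "c *\<^sub>C x = (Re c *\<^sub>R re x - Im c *\<^sub>R im x) + \<i> *\<^sub>C (Re c *\<^sub>R im x + Im c *\<^sub>R re x)"
    by (simp flip: re_im)
  then show "re (c *\<^sub>C x) = Re c *\<^sub>R re x - Im c *\<^sub>R im x"
    "im (c *\<^sub>C x) = Re c *\<^sub>R im x + Im c *\<^sub>R re x"
    using re_im_unique by (simp_all add: selfadjoint_closed)
qed

section \<open>Characters and their construction from total preorders\<close>

definition characters :: "('a \<Rightarrow> complex) set"
  where "characters = {\<xi>. (\<forall>x y. \<xi> (x + y) = \<xi> x + \<xi> y) \<and> (\<forall>c x. \<xi> (c *\<^sub>C x) = c * \<xi> x) \<and>
    (\<forall>x y. \<xi> (x * y) = \<xi> x * \<xi> y) \<and> \<xi> 1 = 1 \<and> (\<forall>x. \<xi> (adj x) = cnj (\<xi> x))}"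

lemma character_simps:
  assumes "\<xi> \<in> characters"
  shows "\<xi> (x + y) = \<xi> x + \<xi> y" "\<xi> (c *\<^sub>C x) = c * \<xi> x" "\<xi> (x * y) = \<xi> x * \<xi> y" "\<xi> 1 = 1"
    "\<xi> (adj x) = cnj (\<xi> x)" "\<xi> (r *\<^sub>R x) = of_real r * \<xi> x" "\<xi> (- x) = - \<xi> x"
    "\<xi> (x - y) = \<xi> x - \<xi> y" "\<xi> 0 = 0"
proof -
  show *: "\<xi> (x + y) = \<xi> x + \<xi> y" "\<xi> (c *\<^sub>C x) = c * \<xi> x" "\<xi> (x * y) = \<xi> x * \<xi> y" "\<xi> 1 = 1"
    "\<xi> (adj x) = cnj (\<xi> x)" for x y c
    using assms by (auto simp: characters_def)
  show "\<xi> (r *\<^sub>R x) = of_real r * \<xi> x" for r x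
    by (simp add: scaleR_scaleC *)
  from this[of "-1"] this[of 0] show neg: "\<xi> (- x) = - \<xi> x" and "\<xi> 0 = 0" for x
    by simp_all
  show "\<xi> (x - y) = \<xi> x - \<xi> y"
    using *(1)[of x "- y"] by (simp add: neg)
qed

text \<open>A total preorder makes the selfadjoint elements an ordered ring in which every element
  differs from a unique real scalar by an infinitesimal; the infinitesimals form an ideal.\<close>

lemma character_of_total_preorder:
  assumes Q: "preorder_cone Q" and proper: "-1 \<notin> Q"
    and total: "\<And>h. h \<in> selfadjoint \<Longrightarrow> h \<in> Q \<or> - h \<in> Q"
  obtains \<xi> where "\<xi> \<in> characters"
    "\<And>h t. h \<in> selfadjoint \<Longrightarrow> (\<And>e. e > 0 \<Longrightarrow> e *\<^sub>R 1 - (h - t *\<^sub>R 1) \<in> Q) \<Longrightarrow>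
      (\<And>e. e > 0 \<Longrightarrow> e *\<^sub>R 1 + (h - t *\<^sub>R 1) \<in> Q) \<Longrightarrow> \<xi> h = of_real t"
proof -
  note closed = preorder_coneD[OF Q] and scaled = preorder_cone_scaleR[OF Q]
  define I where "I = {k \<in> selfadjoint. \<forall>e>0. e *\<^sub>R 1 - k \<in> Q \<and> e *\<^sub>R 1 + k \<in> Q}"
  have negI: "- k \<in> I" if "k \<in> I" for k
    using that by (auto simp: I_def selfadjoint_closed)
  have addI: "k + l \<in> I" if "k \<in> I" "l \<in> I" for k l
  proof -
    have "e *\<^sub>R 1 - (k + l) \<in> Q" "e *\<^sub>R 1 + (k + l) \<in> Q" if "e > 0" for e :: real
    proof -
      have half: "e *\<^sub>R 1 = (e/2) *\<^sub>R 1 + (e/2) *\<^sub>R (1 :: 'a)"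
        by (simp flip: scaleR_add_left)
      have "(e/2) *\<^sub>R 1 - k \<in> Q" "(e/2) *\<^sub>R 1 + k \<in> Q" "(e/2) *\<^sub>R 1 - l \<in> Q" "(e/2) *\<^sub>R 1 + l \<in> Q"
        using \<open>k \<in> I\<close> \<open>l \<in> I\<close> \<open>e > 0\<close> by (auto simp: I_def)
      from closed(3)[OF this(1,3)] closed(3)[OF this(2,4)]
      show "e *\<^sub>R 1 - (k + l) \<in> Q" "e *\<^sub>R 1 + (k + l) \<in> Q"
        unfolding half by (simp_all add: algebra_simps)
    qed
    then show ?thesis using that by (simp add: I_def selfadjoint_closed)
  qed
  have multI_pos: "h * k \<in> I" if "k \<in> I" "h \<in> Q" for h k
  proof -
    \<comment> \<open>With a scalar \<open>b\<close> above \<open>h\<close>, the difference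
      \<open>e - h l\<close> is \<open>h (e/b - l) + (e/b) (b - h)\<close>, a sum of elements of
      \<open>Q\<close>.\<close>
    have "e *\<^sub>R 1 - h * l \<in> Q" if "e > 0" "l \<in> I" for e :: real and l
    proof -
      define b where "b = norm h + 1"
      have b: "b > 0" "b *\<^sub>R 1 - h \<in> Q"
        using preorder_cone_norm[OF Q, of h b] closed(1)[OF \<open>h \<in> Q\<close>] by (simp_all add: b_def add_nonneg_pos)
      then have "(e/b) *\<^sub>R 1 - l \<in> Q"
        using that by (simp add: I_def)
      then have "h * ((e/b) *\<^sub>R 1 - l) + (e/b) *\<^sub>R (b *\<^sub>R 1 - h) \<in> Q"
        using b that \<open>h \<in> Q\<close> by (intro closed scaled) auto
      also have "h * ((e/b) *\<^sub>R 1 - l) + (e/b) *\<^sub>R (b *\<^sub>R 1 - h) = e *\<^sub>R 1 - h * l"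
        using b by (simp add: algebra_simps)
      finally show ?thesis .
    qed
    from this[OF _ that(1)] this[OF _ negI[OF that(1)]]
    show ?thesis
      using that closed(1) by (simp add: I_def selfadjoint_closed)
  qed
  have multI: "h * k \<in> I" if "k \<in> I" "h \<in> selfadjoint" for h k
    using total[OF that(2)] multI_pos[OF that(1)] negI by fastforce
  have scalar: "d = 0" if "d *\<^sub>R 1 \<in> I" for d :: real
  proof (rule ccontr)
    assume "d \<noteq> 0"
    then have "(\<bar>d\<bar>/2) *\<^sub>R 1 - d *\<^sub>R 1 \<in> Q" "(\<bar>d\<bar>/2) *\<^sub>R 1 + d *\<^sub>R 1 \<in> Q"
      using that by (auto simp: I_def)
    then have "(- (\<bar>d\<bar>/2)) *\<^sub>R 1 \<in> Q"
      by (cases "d > 0") (simp_all flip: scaleR_diff_left scaleR_add_left)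
    then have "(2/\<bar>d\<bar>) *\<^sub>R ((- (\<bar>d\<bar>/2)) *\<^sub>R 1) \<in> Q"
      by (rule scaled[rotated]) simp
    then show False using proper \<open>d \<noteq> 0\<close> by simp
  qed
  have ex: "\<exists>t. h - t *\<^sub>R 1 \<in> I" if h: "h \<in> selfadjoint" for h
  proof -
    \<comment> \<open>The scalar part of \<open>h\<close> is the infimum of this upper Dedekind cut.
      Scalars below the infimum lie outside \<open>S\<close>, and totality turns this into the
      estimate from the other side.\<close>
    define S where "S = {r. r *\<^sub>R 1 - h \<in> Q}"
    have up: "s \<in> S" if "r \<in> S" "r \<le> s" for r s
    proof -
      have "(r *\<^sub>R 1 - h) + (s - r) *\<^sub>R 1 \<in> Q"
        using that preorder_cone_scaleR_1[OF Q] by (intro closed) (auto simp: S_def)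
      then show ?thesis by (simp add: S_def algebra_simps)
    qed
    have ne: "norm h \<in> S"
      using preorder_cone_norm[OF Q h] by (simp add: S_def)
    \<comment> \<open>The offset \<open>- 1\<close> is chosen so that the two memberships in
      \<open>Q\<close> below add up to \<open>-1\<close>.\<close>
    have lower: "- norm h - 1 \<le> r" if "r \<in> S" for r
    proof (rule ccontr)
      assume "\<not> - norm h - 1 \<le> r"
      then have "- norm h - 1 \<in> S" using up[OF that] by simp
      moreover have "norm h *\<^sub>R 1 - (- h) \<in> Q"
        using preorder_cone_norm[OF Q, of "- h"] h by (simp add: selfadjoint_closed)
      ultimately have "((- norm h - 1) *\<^sub>R 1 - h) + (norm h *\<^sub>R 1 - (- h)) \<in> Q"
        unfolding S_def by (intro closed) auto
      then show False using proper by (simp add: algebra_simps)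
    qed
    then have bdd: "bdd_below S" by (rule bdd_belowI)
    have "e *\<^sub>R 1 - (h - Inf S *\<^sub>R 1) \<in> Q" "e *\<^sub>R 1 + (h - Inf S *\<^sub>R 1) \<in> Q" if e: "e > 0" for e :: real
    proof -
      obtain r where "r \<in> S" "r < Inf S + e"
        using cInf_lessD[of S "Inf S + e"] ne e by auto
      then have "Inf S + e \<in> S" using up[of r] by simp
      then show "e *\<^sub>R 1 - (h - Inf S *\<^sub>R 1) \<in> Q"
        by (simp add: S_def algebra_simps)
      have "Inf S - e \<notin> S" using cInf_lower[OF _ bdd, of "Inf S - e"] e by auto
      then have "- ((Inf S - e) *\<^sub>R 1 - h) \<in> Q"
        using total[of "(Inf S - e) *\<^sub>R 1 - h"] h by (auto simp: S_def selfadjoint_closed)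
      then show "e *\<^sub>R 1 + (h - Inf S *\<^sub>R 1) \<in> Q"
        by (simp add: algebra_simps)
    qed
    then have "h - Inf S *\<^sub>R 1 \<in> I"
      using h by (simp add: I_def selfadjoint_closed)
    then show ?thesis ..
  qed
  define \<phi> where "\<phi> h = (SOME t. h - t *\<^sub>R 1 \<in> I)" for h
  have \<phi>: "h - \<phi> h *\<^sub>R 1 \<in> I" if "h \<in> selfadjoint" for h
    using someI_ex[OF ex[OF that]] by (simp add: \<phi>_def)
  have \<phi>_eq: "\<phi> h = t" if "h - t *\<^sub>R 1 \<in> I" "h \<in> selfadjoint" for h t
  proof -
    have "(h - t *\<^sub>R 1) + - (h - \<phi> h *\<^sub>R 1) \<in> I"
      using addI negI \<phi> that by blast
    also have "(h - t *\<^sub>R 1) + - (h - \<phi> h *\<^sub>R 1) = (\<phi> h - t) *\<^sub>R 1"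
      by (simp add: algebra_simps)
    finally have "\<phi> h - t = 0" by (rule scalar)
    then show ?thesis by simp
  qed
  have \<phi>_add: "\<phi> (h + k) = \<phi> h + \<phi> k" if "h \<in> selfadjoint" "k \<in> selfadjoint" for h k
  proof (rule \<phi>_eq)
    have "(h - \<phi> h *\<^sub>R 1) + (k - \<phi> k *\<^sub>R 1) \<in> I"
      using addI \<phi> that by blast
    then show "h + k - (\<phi> h + \<phi> k) *\<^sub>R 1 \<in> I"
      by (simp add: algebra_simps)
  qed (simp add: that selfadjoint_closed)
  have \<phi>_mult: "\<phi> (h * k) = \<phi> h * \<phi> k" if "h \<in> selfadjoint" "k \<in> selfadjoint" for h k
  proof (rule \<phi>_eq)
    have "\<phi> k *\<^sub>R 1 \<in> selfadjoint" by (simp add: selfadjoint_closed)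
    then have "h * (k - \<phi> k *\<^sub>R 1) + (\<phi> k *\<^sub>R 1) * (h - \<phi> h *\<^sub>R 1) \<in> I"
      using addI multI \<phi> that by blast
    then show "h * k - (\<phi> h * \<phi> k) *\<^sub>R 1 \<in> I"
      by (simp add: algebra_simps)
  qed (simp add: that selfadjoint_closed)
  have "0 \<in> I" using preorder_cone_scaleR_1[OF Q] by (simp add: I_def selfadjoint_closed)
  then have \<phi>_scalar: "\<phi> (r *\<^sub>R 1) = r" for r
    by (intro \<phi>_eq) (simp_all add: selfadjoint_closed)
  have \<phi>_scaleR: "\<phi> (r *\<^sub>R h) = r * \<phi> h" if "h \<in> selfadjoint" for r h
    using \<phi>_mult[of "r *\<^sub>R 1" h] that by (simp add: \<phi>_scalar selfadjoint_closed)
  have \<phi>_minus: "\<phi> (- h) = - \<phi> h" if "h \<in> selfadjoint" for h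
    using \<phi>_scaleR[OF that, of "-1"] by simp
  have \<phi>_diff: "\<phi> (h - k) = \<phi> h - \<phi> k" if "h \<in> selfadjoint" "k \<in> selfadjoint" for h k
    using \<phi>_add[of h "- k"] that by (simp add: \<phi>_minus selfadjoint_closed)
  define \<xi> where "\<xi> x = Complex (\<phi> (re x)) (\<phi> (im x))" for x
  have re_self: "re h = h" and im_self: "im h = 0" if "h \<in> selfadjoint" for h
    using re_im_unique[OF that, of 0] by (simp_all add: selfadjoint_closed)
  show ?thesis
  proof
    have "\<phi> 1 = 1" "\<phi> 0 = 0" using \<phi>_scalar[of 1] \<phi>_scalar[of 0] by simp_all
    then show "\<xi> \<in> characters"
      by (auto simp: characters_def \<xi>_def re_im_simps \<phi>_add \<phi>_mult \<phi>_scaleR \<phi>_minus \<phi>_diff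
          selfadjoint_closed complex_eq_iff re_self im_self)
    fix h t
    assume "h \<in> selfadjoint" "\<And>e. e > 0 \<Longrightarrow> e *\<^sub>R 1 - (h - t *\<^sub>R 1) \<in> Q"
      "\<And>e. e > 0 \<Longrightarrow> e *\<^sub>R 1 + (h - t *\<^sub>R 1) \<in> Q"
    then have "h - t *\<^sub>R 1 \<in> I" "h \<in> selfadjoint" by (auto simp: I_def selfadjoint_closed)
    then show "\<xi> h = of_real t"
      using \<open>\<phi> 0 = 0\<close> by (simp add: \<xi>_def re_self im_self \<phi>_eq complex_eq_iff)
  qed
qed

text \<open>Let \<open>h = x\<^sup>* x\<close> and \<open>c = \<parallel>h\<parallel>\<close>.  If the preorder generated by \<open>h - c\<close> contained \<open>-1\<close>, then
  \<open>0 \<le> h \<le> c - 1/b\<close> for some \<open>b > 0\<close>, so \<open>\<parallel>h\<parallel> < c\<close>.\<close>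

lemma norm_eq_character:
  assumes "x \<noteq> 0"
  obtains \<xi> where "\<xi> \<in> characters" "cmod (\<xi> x) = norm x"
proof -
  define h where "h = adj x * x"
  define c where "c = (norm x)\<^sup>2"
  have c: "c > 0" "norm h = c" using assms by (simp_all add: c_def h_def norm_adj_mult)
  have h_sa: "h \<in> selfadjoint" by (simp add: h_def selfadjoint_def adj_simps mult.commute)
  have "re h = re x * re x + im x * im x" "im h = 0"
    by (simp_all add: h_def re_im_simps selfadjoint_closed algebra_simps)
  then have "h = re x * re x + im x * im x"
    using re_im[of h] by simp
  moreover have "re x * re x \<in> squares" "im x * im x \<in> squares"
    using selfadjoint_closed(8,9)[of x] by (auto simp: squares_def)
  ultimately have h_sq: "h \<in> squares"
    by (simp add: squares_add)
  note P = preorder_cone_squares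
  note closed = preorder_coneD[OF P]
  have "h - c *\<^sub>R 1 \<in> selfadjoint" by (simp add: h_sa selfadjoint_closed)
  note E = preorder_cone_extend[OF P this]
  have "-1 \<notin> {p + (h - c *\<^sub>R 1) * q | p q. p \<in> squares \<and> q \<in> squares}"
  proof
    assume "-1 \<in> {p + (h - c *\<^sub>R 1) * q | p q. p \<in> squares \<and> q \<in> squares}"
    then obtain p q where pq: "p \<in> squares" "q \<in> squares" "-1 = p + (h - c *\<^sub>R 1) * q" by blast
    \<comment> \<open>Being above \<open>norm q\<close> makes \<open>b - q\<close> a square; being
      above \<open>1/c\<close> makes the new bound \<open>c - 1/b\<close> positive, as
      \<open>norm_square_le\<close> demands. Expanding \<open>(c - h) (b - q) + p\<close> and
      inserting the formula for \<open>-1\<close> leaves \<open>b (c - h) - 1\<close>.\<close>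
    define b where "b = norm q + 1 + 1/c"
    have b: "b > 0" "1 / b < c"
    proof -
      have "1 / c < b" "0 < b" using c by (simp_all add: b_def add_nonneg_pos add_pos_pos)
      then show "b > 0" "1 / b < c" using c by (simp_all add: field_simps)
    qed
    have "b *\<^sub>R 1 - q \<in> squares"
      using preorder_cone_norm[OF P closed(1)[OF pq(2)], of b] c by (simp add: b_def)
    moreover have "c *\<^sub>R 1 - h \<in> squares"
      using preorder_cone_norm[OF P h_sa, of c] c by simp
    ultimately have "(c *\<^sub>R 1 - h) * (b *\<^sub>R 1 - q) + p \<in> squares"
      using closed pq(1) by blast
    also have "(c *\<^sub>R 1 - h) * (b *\<^sub>R 1 - q) + p = b *\<^sub>R (c *\<^sub>R 1 - h) + (p + (h - c *\<^sub>R 1) * q)"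
      by (simp add: algebra_simps)
    also have "\<dots> = b *\<^sub>R (c *\<^sub>R 1 - h) + - 1"
      by (simp only: pq(3))
    also have "\<dots> = b *\<^sub>R ((c - 1 / b) *\<^sub>R 1 - h)"
      using b by (simp add: algebra_simps)
    finally have "b *\<^sub>R ((c - 1 / b) *\<^sub>R 1 - h) \<in> squares" .
    from preorder_cone_scaleR[OF P _ this, of "1 / b"]
    have "(c - 1 / b) *\<^sub>R 1 - h \<in> squares"
      using b by simp
    then obtain s where s: "s \<in> selfadjoint" "(c - 1 / b) *\<^sub>R 1 - h = s * s"
      by (auto simp: squares_def)
    obtain t where t: "t \<in> selfadjoint" "h = t * t"
      using h_sq by (auto simp: squares_def)
    have "norm (t * t) \<le> c - 1 / b"
      using b s(2) t(2) by (intro norm_square_le[OF t(1) s(1)]) (simp_all add: algebra_simps)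
    then show False using b c by (simp flip: t(2))
  qed
  from total_preorder_exists[OF E(1) this] obtain Q where Q: "preorder_cone Q" "-1 \<notin> Q"
    "{p + (h - c *\<^sub>R 1) * q | p q. p \<in> squares \<and> q \<in> squares} \<subseteq> Q"
    "\<And>h. h \<in> selfadjoint \<Longrightarrow> h \<in> Q \<or> - h \<in> Q"
    by blast
  from character_of_total_preorder[OF Q(1,2,4)]
  obtain \<xi> where \<xi>: "\<xi> \<in> characters" "\<And>h t. h \<in> selfadjoint \<Longrightarrow>
      (\<And>e. e > 0 \<Longrightarrow> e *\<^sub>R 1 - (h - t *\<^sub>R 1) \<in> Q) \<Longrightarrow>
      (\<And>e. e > 0 \<Longrightarrow> e *\<^sub>R 1 + (h - t *\<^sub>R 1) \<in> Q) \<Longrightarrow> \<xi> h = of_real t"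
    by blast
  \<comment> \<open>Since \<open>h - c\<close> and \<open>c - h\<close> both lie in
    \<open>Q\<close>, the element \<open>h\<close> is infinitesimally close to \<open>c\<close>,
    which fixes the value of the character.\<close>
  have "h - c *\<^sub>R 1 \<in> Q" using E(3) Q(3) by blast
  moreover have "- (h - c *\<^sub>R 1) \<in> Q"
    using preorder_cone_norm[OF Q(1) h_sa, of c] c by simp
  ultimately have "\<xi> h = of_real c"
    using preorder_cone_scaleR_1[OF Q(1)] preorder_coneD(3)[OF Q(1)] h_sa
    by (intro \<xi>(2)) (auto simp only: diff_conv_add_uminus less_imp_le)
  then have "cnj (\<xi> x) * \<xi> x = of_real c"
    by (simp add: h_def character_simps[OF \<xi>(1)])
  then have "of_real ((cmod (\<xi> x))\<^sup>2) = (of_real c :: complex)"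
    unfolding complex_norm_square by (simp add: mult.commute)
  then have "(cmod (\<xi> x))\<^sup>2 = (norm x)\<^sup>2"
    by (simp only: of_real_eq_iff c_def)
  then show ?thesis
    using that \<xi>(1) by simp
qed

text \<open>The element \<open>(norm x)^2 - adj x * x\<close> has a selfadjoint root
  \<open>a\<close>. Since \<open>\<xi> a\<close> is real, applying \<open>\<xi>\<close> shows that
  \<open>(norm x)^2 - (cmod (\<xi> x))^2\<close> is nonnegative. Continuity, which is not part of
  \<open>characters\<close>, follows from this bound.\<close>

lemma character_le_norm:
  assumes \<xi>: "\<xi> \<in> characters"
  shows "cmod (\<xi> x) \<le> norm x"
proof -
  have real: "cnj (\<xi> a) = \<xi> a" if "a \<in> selfadjoint" for a
    using character_simps(5)[OF \<xi>, of a] that by (simp add: selfadjoint_def)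
  have "adj x * x \<in> selfadjoint" by (simp add: selfadjoint_def adj_simps mult.commute)
  then obtain a where a: "a \<in> selfadjoint" "a * a = (norm x)\<^sup>2 *\<^sub>R 1 - adj x * x"
    using sqrt_exists[of "adj x * x" "(norm x)\<^sup>2"] by (auto simp: norm_adj_mult)
  have "of_real ((cmod (\<xi> a))\<^sup>2) = \<xi> (a * a)"
    unfolding complex_norm_square by (simp add: character_simps[OF \<xi>] real a(1))
  also have "\<dots> = of_real ((norm x)\<^sup>2 - (cmod (\<xi> x))\<^sup>2)"
    unfolding a(2) of_real_diff complex_norm_square
    by (simp add: character_simps[OF \<xi>] mult.commute)
  finally have "(cmod (\<xi> a))\<^sup>2 = (norm x)\<^sup>2 - (cmod (\<xi> x))\<^sup>2"
    by (simp only: of_real_eq_iff)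
  then have "(cmod (\<xi> x))\<^sup>2 \<le> (norm x)\<^sup>2"
    using zero_le_power2[of "cmod (\<xi> a)"] by linarith
  then show ?thesis by (rule power2_le_imp_le) simp
qed

lemma character_separation:
  assumes "\<And>\<xi>. \<xi> \<in> characters \<Longrightarrow> \<xi> x = \<xi> y"
  shows "x = y"
proof (rule ccontr)
  assume "x \<noteq> y"
  then have "x - y \<noteq> 0" by simp
  then obtain \<xi> where \<xi>: "\<xi> \<in> characters" "cmod (\<xi> (x - y)) = norm (x - y)"
    using norm_eq_character by blast
  have "\<xi> (x - y) = 0"
    using assms[OF \<xi>(1)] by (simp add: character_simps[OF \<xi>(1)])
  then show False using \<xi>(2) \<open>x \<noteq> y\<close> by simp
qed

text \<open>Tychonoff's theorem for the product of the discs of radius \<open>norm x\<close>. The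
  defining equations involve finitely many coordinates each, so they cut out a closed
  subset.\<close>

lemma compact_characters: "compact characters"
proof -
  have "compactin euclidean (PiE UNIV (\<lambda>x. cball (0 :: complex) (norm (x :: 'a))))"
    unfolding euclidean_product_topology[symmetric] compactin_PiE by simp
  then have "compact (PiE UNIV (\<lambda>x. cball (0 :: complex) (norm (x :: 'a))))"
    by simp
  moreover have "closed characters"
    unfolding characters_def
    by (intro closed_Collect_conj closed_Collect_all closed_Collect_eq continuous_intros
        continuous_on_product_coordinates)
  moreover have "characters \<subseteq> PiE UNIV (\<lambda>x. cball (0 :: complex) (norm (x :: 'a)))"
    using character_le_norm by auto
  ultimately show ?thesis
    by (metis compact_Int_closed inf.absorb_iff2)
qed

section \<open>Stone-Weierstrass on the space of characters\<close>

lemma character_selfadjoint: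
  assumes "\<xi> \<in> characters" "h \<in> selfadjoint"
  shows "\<xi> h = of_real (Re (\<xi> h))"
  using character_simps(5)[OF assms(1), of h] assms(2)
  by (simp add: selfadjoint_def complex_eq_iff)

text \<open>Real-valued to fit the real Stone-Weierstrass theorem, and prescribed on
  \<open>characters\<close> only, the compact set on which approximation takes place.\<close>

definition character_functions :: "(('a \<Rightarrow> complex) \<Rightarrow> real) set"
  where "character_functions = {f. \<exists>h\<in>selfadjoint. \<forall>\<xi>\<in>characters. f \<xi> = Re (\<xi> h)}"

lemma function_ring_on_characters: "function_ring_on character_functions characters"
proof
  show "compact characters" by (rule compact_characters)
next
  fix f assume "f \<in> character_functions"
  then obtain h where h: "\<And>\<xi>. \<xi> \<in> characters \<Longrightarrow> f \<xi> = Re (\<xi> h)"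
    by (auto simp: character_functions_def)
  have "continuous_on characters (\<lambda>\<xi>. Re (\<xi> h))"
    by (intro continuous_on_Re continuous_on_subset[OF continuous_on_product_coordinates]) simp
  then show "continuous_on characters f"
    by (subst continuous_on_cong[OF refl h])
next
  fix f g assume "f \<in> character_functions" "g \<in> character_functions"
  then obtain h k where hk: "h \<in> selfadjoint" "k \<in> selfadjoint"
    "\<And>\<xi>. \<xi> \<in> characters \<Longrightarrow> f \<xi> = Re (\<xi> h)" "\<And>\<xi>. \<xi> \<in> characters \<Longrightarrow> g \<xi> = Re (\<xi> k)"
    by (auto simp: character_functions_def)
  show "(\<lambda>\<xi>. f \<xi> + g \<xi>) \<in> character_functions"
    unfolding character_functions_def using hk
    by (auto intro!: bexI[of _ "h + k"] simp: character_simps selfadjoint_closed)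
  \<comment> \<open>The real part of a product contains a product of imaginary parts, which has to
    vanish.\<close>
  have "Im (\<xi> h) = 0" if "\<xi> \<in> characters" for \<xi>
    using character_selfadjoint[OF that hk(1)] by (metis Im_complex_of_real)
  then show "(\<lambda>\<xi>. f \<xi> * g \<xi>) \<in> character_functions"
    unfolding character_functions_def using hk
    by (auto intro!: bexI[of _ "h * k"] simp: character_simps selfadjoint_closed)
next
  fix c
  show "(\<lambda>\<xi>. c) \<in> character_functions"
    unfolding character_functions_def
    by (auto intro!: bexI[of _ "c *\<^sub>R 1"] simp: character_simps selfadjoint_closed)
next
  fix \<xi> \<eta> assume *: "\<xi> \<in> characters" "\<eta> \<in> characters" "\<xi> \<noteq> \<eta>"
  then obtain x where "\<xi> x \<noteq> \<eta> x" by auto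
  then have "\<xi> (re x + \<i> *\<^sub>C im x) \<noteq> \<eta> (re x + \<i> *\<^sub>C im x)"
    by (simp flip: re_im)
  then have "\<xi> (re x) \<noteq> \<eta> (re x) \<or> \<xi> (im x) \<noteq> \<eta> (im x)"
    using * by (auto simp: character_simps)
  then obtain h where "h \<in> selfadjoint" "\<xi> h \<noteq> \<eta> h"
    using selfadjoint_closed(8,9)[of x] by metis
  then have "h \<in> selfadjoint" "Re (\<xi> h) \<noteq> Re (\<eta> h)"
    using character_selfadjoint *(1,2) by metis+
  then show "\<exists>f\<in>character_functions. f \<xi> \<noteq> f \<eta>"
    by (intro bexI[of _ "\<lambda>\<xi>. Re (\<xi> h)"]) (auto simp: character_functions_def)
qed

text \<open>The assumption \<open>0 \<le> r\<close> settles \<open>x = 0\<close>, including the zero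
  algebra, where no character exists.\<close>

lemma norm_le_of_characters:
  assumes "\<And>\<xi>. \<xi> \<in> characters \<Longrightarrow> cmod (\<xi> x) \<le> r" "0 \<le> r"
  shows "norm x \<le> r"
proof (cases "x = 0")
  case False
  then obtain \<xi> where "\<xi> \<in> characters" "cmod (\<xi> x) = norm x"
    using norm_eq_character by blast
  then show ?thesis using assms(1)[of \<xi>] by simp
qed (use assms in simp)

text \<open>Stone-Weierstrass yields elements whose values approximate \<open>g\<close> uniformly.
  Characters determine the norm, so these elements form a Cauchy sequence in the algebra, and the
  values at its limit are those of \<open>g\<close>.\<close>

lemma real_character_function_surj:
  fixes g :: "('a \<Rightarrow> complex) \<Rightarrow> real"
  assumes g: "continuous_on characters g"
  obtains h where "\<And>\<xi>. \<xi> \<in> characters \<Longrightarrow> \<xi> h = of_real (g \<xi>)"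
proof -
  interpret function_ring_on character_functions characters
    by (rule function_ring_on_characters)
  have "\<exists>h\<in>selfadjoint. \<forall>\<xi>\<in>characters. \<bar>g \<xi> - Re (\<xi> h)\<bar> < inverse (real (Suc n))" for n
  proof -
    obtain f where f: "f \<in> character_functions"
      "\<And>\<xi>. \<xi> \<in> characters \<Longrightarrow> \<bar>g \<xi> - f \<xi>\<bar> < inverse (real (Suc n))"
      using Stone_Weierstrass_basic[OF g, of "inverse (real (Suc n))"] by auto
    from f(1) obtain h where "h \<in> selfadjoint" "\<And>\<xi>. \<xi> \<in> characters \<Longrightarrow> f \<xi> = Re (\<xi> h)"
      by (auto simp: character_functions_def)
    then show ?thesis using f(2) by (intro bexI[of _ h] ballI) auto
  qed
  then obtain h where h: "\<And>n. h n \<in> selfadjoint"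
    and approx: "\<And>n \<xi>. \<xi> \<in> characters \<Longrightarrow> \<bar>g \<xi> - Re (\<xi> (h n))\<bar> < inverse (real (Suc n))"
    by metis
  have approx': "cmod (\<xi> (h n) - of_real (g \<xi>)) < inverse (real (Suc n))"
    if "\<xi> \<in> characters" for \<xi> n
  proof -
    have "\<xi> (h n) - of_real (g \<xi>) = of_real (Re (\<xi> (h n)) - g \<xi>)"
      by (subst character_selfadjoint[OF that h]) simp
    then have "cmod (\<xi> (h n) - of_real (g \<xi>)) = \<bar>Re (\<xi> (h n)) - g \<xi>\<bar>"
      by (simp only: norm_of_real)
    then show ?thesis using approx[OF that, of n] by linarith
  qed
  have "Cauchy h"
  proof (rule metric_CauchyI)
    fix e :: real assume "e > 0"
    then obtain N where N: "inverse (real (Suc N)) < e / 2"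
      using reals_Archimedean[of "e / 2"] by auto
    have "dist (h m) (h n) < e" if "m \<ge> N" "n \<ge> N" for m n
    proof -
      have small: "inverse (real (Suc k)) \<le> inverse (real (Suc N))" if "k \<ge> N" for k
        using that by (simp add: le_imp_inverse_le)
      have "cmod (\<xi> (h m - h n)) \<le> 2 * inverse (real (Suc N))" if \<xi>: "\<xi> \<in> characters" for \<xi>
      proof -
        have "cmod (\<xi> (h m - h n)) \<le>
            cmod (\<xi> (h m) - of_real (g \<xi>)) + cmod (\<xi> (h n) - of_real (g \<xi>))"
          using norm_triangle_ineq4[of "\<xi> (h m) - of_real (g \<xi>)" "\<xi> (h n) - of_real (g \<xi>)"]
          by (simp add: character_simps[OF \<xi>])
        then show ?thesis
          using approx'[OF \<xi>, of m] approx'[OF \<xi>, of n] small[OF \<open>m \<ge> N\<close>] small[OF \<open>n \<ge> N\<close>]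
          by linarith
      qed
      then have "norm (h m - h n) \<le> 2 * inverse (real (Suc N))"
        by (rule norm_le_of_characters) auto
      then show ?thesis using N unfolding dist_norm by linarith
    qed
    then show "\<exists>M. \<forall>m\<ge>M. \<forall>n\<ge>M. dist (h m) (h n) < e" by blast
  qed
  then obtain l where l: "h \<longlonglongrightarrow> l"
    using Cauchy_convergent convergent_def by blast
  have "\<xi> l = of_real (g \<xi>)" if \<xi>: "\<xi> \<in> characters" for \<xi>
  proof (rule LIMSEQ_unique)
    have "(\<lambda>n. \<xi> (h n) - \<xi> l) \<longlonglongrightarrow> 0"
    proof (rule Lim_null_comparison)
      show "\<forall>\<^sub>F n in sequentially. cmod (\<xi> (h n) - \<xi> l) \<le> norm (h n - l)"
        using character_le_norm[OF \<xi>] by (simp flip: character_simps(8)[OF \<xi>])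
      show "(\<lambda>n. norm (h n - l)) \<longlonglongrightarrow> 0"
        using l by (simp add: LIM_zero tendsto_norm_zero)
    qed
    then show "(\<lambda>n. \<xi> (h n)) \<longlonglongrightarrow> \<xi> l" by (rule LIM_zero_cancel)
    have "(\<lambda>n. \<xi> (h n) - of_real (g \<xi>)) \<longlonglongrightarrow> 0"
      using approx'[OF \<xi>]
      by (intro Lim_null_comparison[OF _ LIMSEQ_inverse_real_of_nat]) (auto simp: less_imp_le)
    then show "(\<lambda>n. \<xi> (h n)) \<longlonglongrightarrow> of_real (g \<xi>)" by (rule LIM_zero_cancel)
  qed
  then show ?thesis using that by blast
qed

lemma character_function_surj:
  fixes g :: "('a \<Rightarrow> complex) \<Rightarrow> complex"
  assumes "continuous_on characters g"
  obtains x where "\<And>\<xi>. \<xi> \<in> characters \<Longrightarrow> \<xi> x = g \<xi>"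
proof -
  obtain h where h: "\<And>\<xi>. \<xi> \<in> characters \<Longrightarrow> \<xi> h = of_real (Re (g \<xi>))"
    using real_character_function_surj[OF continuous_on_Re[OF assms]] by blast
  obtain k where k: "\<And>\<xi>. \<xi> \<in> characters \<Longrightarrow> \<xi> k = of_real (Im (g \<xi>))"
    using real_character_function_surj[OF continuous_on_Im[OF assms]] by blast
  have "\<xi> (h + \<i> *\<^sub>C k) = g \<xi>" if "\<xi> \<in> characters" for \<xi>
    using that by (simp add: character_simps[OF that] h k flip: complex_eq)
  then show ?thesis using that by blast
qed

end

section \<open>The Gelfand transform of a symmetric Krein C*-algebra\<close>

lift_definition K_fst :: "kmat \<Rightarrow> complex" is "\<lambda>M. M$1$1" .

lift_definition K_snd :: "kmat \<Rightarrow> complex" is "\<lambda>M. M$1$2" .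

lemma K_fst_T [simp]: "K_fst (T a b) = a"
  by transfer simp

lemma K_snd_T [simp]: "K_snd (T a b) = b"
  by transfer simp

lemma T_K_fst_snd [simp]: "T (K_fst k) (K_snd k) = k"
  by (cases k) simp

text \<open>The operator norm is equivalent to the coordinate norms, so continuity into
  \<open>kmat\<close> can be tested on the two entries.\<close>

lemma norm_T_bounds:
  "cmod a \<le> norm (T a b)" "cmod b \<le> norm (T a b)" "norm (T a b) \<le> cmod a + cmod b"
proof -
  have "2 * a = (a + b) + (a - b)" "2 * b = (a + b) - (a - b)" by simp_all
  then have "cmod (2 * a) \<le> cmod (a + b) + cmod (a - b)" "cmod (2 * b) \<le> cmod (a + b) + cmod (a - b)"
    by (metis norm_triangle_ineq, metis norm_triangle_ineq4)
  then show "cmod a \<le> norm (T a b)" "cmod b \<le> norm (T a b)"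
    by (auto simp: T_ops norm_mult max_def)
  show "norm (T a b) \<le> cmod a + cmod b"
    by (simp add: T_ops norm_triangle_ineq norm_triangle_ineq4)
qed

lemma bounded_linear_K_fst: "bounded_linear K_fst"
proof (rule bounded_linear_intro[of _ 1])
  fix x y :: kmat and r :: real
  show "K_fst (x + y) = K_fst x + K_fst y"
    by (cases x; cases y) (simp add: T_ops)
  show "K_fst (r *\<^sub>R x) = r *\<^sub>R K_fst x"
    by (cases x) (simp add: T_ops scaleR_conv_of_real)
  show "cmod (K_fst x) \<le> norm x * 1"
    by (cases x) (simp add: norm_T_bounds)
qed

lemma bounded_linear_K_snd: "bounded_linear K_snd"
proof (rule bounded_linear_intro[of _ 1])
  fix x y :: kmat and r :: real
  show "K_snd (x + y) = K_snd x + K_snd y"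
    by (cases x; cases y) (simp add: T_ops)
  show "K_snd (r *\<^sub>R x) = r *\<^sub>R K_snd x"
    by (cases x) (simp add: T_ops scaleR_conv_of_real)
  show "cmod (K_snd x) \<le> norm x * 1"
    by (cases x) (simp add: norm_T_bounds)
qed

lemma continuous_on_T:
  assumes "continuous_on S f" "continuous_on S g"
  shows "continuous_on S (\<lambda>x. T (f x) (g x))"
proof -
  have "bounded_linear (\<lambda>p. T (fst p) (snd p))"
  proof (rule bounded_linear_intro[of _ 2])
    fix p :: "complex \<times> complex"
    have "norm (T (fst p) (snd p)) \<le> cmod (fst p) + cmod (snd p)"
      by (rule norm_T_bounds)
    also have "\<dots> \<le> norm p + norm p"
      using norm_fst_le[of "fst p" "snd p"] norm_snd_le[of "snd p" "fst p"] by simp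
    finally show "norm (T (fst p) (snd p)) \<le> norm p * 2" by simp
  qed (simp_all add: T_ops scaleR_conv_of_real)
  from bounded_linear.continuous_on[OF this continuous_on_Pair[OF assms]]
  show ?thesis by simp
qed

lemma K_odd_symmetry_eq: "K_odd_symmetry k = T (K_snd k) (K_fst k)"
  by (cases k) simp

section \<open>Equivalence of points of \<Omega> and continuity of evaluations\<close>

lemma unital_star_hom_inv:
  fixes \<phi> :: "kmat \<Rightarrow> kmat"
  assumes \<phi>: "unital_star_hom \<phi>" and bij: "bij \<phi>"
  shows "unital_star_hom (inv \<phi>)"
proof -
  note \<phi>s = \<phi>[unfolded unital_star_hom_def star_hom_def complex_linear_iff]
  have eq: "inv \<phi> y = x" if "y = \<phi> x" for x y
    using that bij by (simp add: bij_is_inj)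
  have surj: "\<phi> (inv \<phi> y) = y" for y
    using bij by (simp add: bij_is_surj surj_f_inv_f)
  show ?thesis
    unfolding unital_star_hom_def star_hom_def complex_linear_iff
    by (intro conjI allI; rule eq) (simp_all add: \<phi>s surj)
qed

lemma equiv_Omega_rel: "equiv (Omega \<alpha>) (Omega_rel \<alpha>)"
proof (rule equivI)
  show "Omega_rel \<alpha> \<subseteq> Omega \<alpha> \<times> Omega \<alpha>"
    by (auto simp: Omega_rel_def)
  have id: "unital_star_hom (id :: kmat \<Rightarrow> kmat)"
    by (simp add: unital_star_hom_def star_hom_def complex_linear_iff)
  then show "refl_on (Omega \<alpha>) (Omega_rel \<alpha>)"
    by (auto simp: refl_on_def Omega_rel_def intro!: exI[of _ id])
  show "sym (Omega_rel \<alpha>)"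
  proof (rule symI)
    fix v w assume "(v, w) \<in> Omega_rel \<alpha>"
    then obtain \<phi> :: "kmat \<Rightarrow> kmat" where *: "v \<in> Omega \<alpha>" "w \<in> Omega \<alpha>" "unital_star_hom \<phi>" "bij \<phi>" "w = \<phi> \<circ> v"
      by (auto simp: Omega_rel_def)
    have "v = inv \<phi> \<circ> w"
      using *(4,5) by (simp add: fun_eq_iff bij_is_inj)
    then show "(w, v) \<in> Omega_rel \<alpha>"
      unfolding Omega_rel_def
      using * unital_star_hom_inv[OF *(3,4)] bij_imp_bij_inv[OF *(4)] by blast
  qed
  show "trans (Omega_rel \<alpha>)"
  proof (rule transI)
    fix u v w assume "(u, v) \<in> Omega_rel \<alpha>" "(v, w) \<in> Omega_rel \<alpha>"
    then obtain \<phi> \<psi> :: "kmat \<Rightarrow> kmat" where *: "u \<in> Omega \<alpha>" "w \<in> Omega \<alpha>"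
      "unital_star_hom \<phi>" "bij \<phi>" "v = \<phi> \<circ> u" "unital_star_hom \<psi>" "bij \<psi>" "w = \<psi> \<circ> v"
      by (auto simp: Omega_rel_def)
    have "unital_star_hom (\<psi> \<circ> \<phi>)"
      using *(3,6) by (simp add: unital_star_hom_def star_hom_def complex_linear_iff)
    moreover have "w = (\<psi> \<circ> \<phi>) \<circ> u" using * by (simp add: comp_assoc)
    ultimately show "(u, w) \<in> Omega_rel \<alpha>"
      unfolding Omega_rel_def using *(1,2) bij_comp[OF *(4,7)] by blast
  qed
qed

lemma continuous_map_Omega_eval: "continuous_map (Omega_topology \<alpha>) euclidean (\<lambda>w. w x)"
  unfolding continuous_map_def
proof (intro conjI allI impI)
  fix U :: "kmat set" assume "openin euclidean U"
  then have "openin (Omega_topology \<alpha>) {w \<in> Omega \<alpha>. w x \<in> U}"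
    unfolding Omega_topology_def by (intro topology_generated_by_Basis) auto
  then show "openin (Omega_topology \<alpha>) {w \<in> topspace (Omega_topology \<alpha>). w x \<in> U}"
    by (simp add: topspace_Omega_topology)
qed auto

section \<open>The associated C*-algebra and the element \<open>e\<close>\<close>

locale symmetric_krein =
  fixes \<alpha> \<epsilon> :: "'a::{banach_star_algebra,comm_monoid_mult} \<Rightarrow> 'a"
  assumes fundamental: "fundamental_symmetry \<alpha>"
    and odd: "odd_symmetry \<epsilon>"
    and compatible: "compatible_symmetries \<alpha> \<epsilon>"
begin

lemma \<alpha>_simps:
  "\<alpha> (x + y) = \<alpha> x + \<alpha> y" "\<alpha> (c *\<^sub>C x) = c *\<^sub>C \<alpha> x" "\<alpha> (x * y) = \<alpha> x * \<alpha> y"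
  "\<alpha> (star x) = star (\<alpha> x)" "\<alpha> (\<alpha> x) = x" "\<alpha> 1 = 1"
proof -
  show *: "\<alpha> (x + y) = \<alpha> x + \<alpha> y" "\<alpha> (c *\<^sub>C x) = c *\<^sub>C \<alpha> x" "\<alpha> (x * y) = \<alpha> x * \<alpha> y"
    "\<alpha> (star x) = star (\<alpha> x)" for x y c
    using fundamental by (auto simp: fundamental_symmetry_def star_hom_def complex_linear_iff)
  show invol: "\<alpha> (\<alpha> x) = x" for x
    by (rule fundamental_symmetry_simps(5)[OF fundamental])
  show "\<alpha> 1 = 1"
    using *(3)[of 1 "\<alpha> 1"] by (simp add: invol)
qed

text \<open>The norm condition on a fundamental symmetry is exactly the C*-identity for
  \<open>dagger \<alpha>\<close>, because \<open>\<alpha>\<close> commutes with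
  \<open>star\<close>.\<close>

sublocale commutative_cstar "dagger \<alpha>"
proof
  show "norm (dagger \<alpha> x * x) = (norm x)\<^sup>2" for x
    using fundamental by (simp add: fundamental_symmetry_def dagger_def \<alpha>_simps(4))
qed (simp_all add: dagger_def \<alpha>_simps star_add star_scaleC star_mult star_star mult.commute flip: \<alpha>_simps(4))

definition e :: 'a
  where "e = \<epsilon> 1"

lemma \<epsilon>_eq: "\<epsilon> x = e * x"
  using odd unfolding odd_symmetry_def e_def by (metis mult_1)

text \<open>Both \<open>star\<close> and \<open>\<alpha>\<close> change the sign of
  \<open>e\<close>. The signs cancel in \<open>dagger \<alpha>\<close>, which makes \<open>e\<close>
  a selfadjoint unitary of the C*-algebra.\<close>

lemma e_simps: "e * e = 1" "\<alpha> e = - e" "dagger \<alpha> e = e"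
proof -
  have "\<epsilon> (\<epsilon> 1) = 1"
    using odd unfolding odd_symmetry_def by (metis comp_apply id_apply)
  then show "e * e = 1"
    by (simp add: \<epsilon>_eq)
  have "\<epsilon> (\<alpha> 1) = - \<alpha> (\<epsilon> 1)"
    using compatible unfolding compatible_symmetries_def by blast
  then have "e = - \<alpha> e" by (simp add: \<alpha>_simps e_def)
  then show \<alpha>: "\<alpha> e = - e" by (metis minus_minus)
  have "star (1 :: 'a) = 1"
    using adj_1 by (simp add: dagger_def \<alpha>_simps)
  moreover have "\<epsilon> (star 1) = - star (\<epsilon> 1)"
    using odd unfolding odd_symmetry_def by blast
  ultimately have "e = - star e" by (simp add: e_def)
  moreover have "dagger \<alpha> e = \<alpha> (star e)" by (simp add: dagger_def \<alpha>_simps(4))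
  ultimately show "dagger \<alpha> e = e"
    by (metis \<alpha> \<alpha>_simps(5) minus_minus)
qed

lemma character_comp:
  assumes "\<xi> \<in> characters"
  shows "\<xi> \<circ> \<alpha> \<in> characters"
proof -
  have "\<alpha> (dagger \<alpha> x) = dagger \<alpha> (\<alpha> x)" for x
    by (simp add: dagger_def \<alpha>_simps(4))
  then show ?thesis
    unfolding characters_def by (simp add: \<alpha>_simps(1-3,6) character_simps[OF assms])
qed

lemma character_star: "\<xi> \<in> characters \<Longrightarrow> \<xi> (star x) = cnj (\<xi> (\<alpha> x))"
  using character_simps(5)[of \<xi> "\<alpha> x"] by (simp add: dagger_def \<alpha>_simps)

lemma character_e:
  assumes "\<xi> \<in> characters"
  shows "\<xi> e = 1 \<or> \<xi> e = -1"
proof -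
  have "\<xi> e * \<xi> e = 1"
    using e_simps(1) character_simps(3,4)[OF assms] by metis
  then show ?thesis by (simp add: square_eq_1_iff)
qed

section \<open>Correspondence between characters and points\<close>

definition K_hom :: "('a \<Rightarrow> complex) \<Rightarrow> 'a \<Rightarrow> kmat"
  where "K_hom \<xi> x = T (\<xi> (even_comp \<alpha> x)) (\<xi> (odd_comp \<alpha> x))"

lemma K_hom_eq:
  assumes "\<xi> \<in> characters"
  shows "K_hom \<xi> x = T ((\<xi> x + \<xi> (\<alpha> x)) / 2) ((\<xi> x - \<xi> (\<alpha> x)) / 2)"
  by (simp add: K_hom_def even_comp_def odd_comp_def character_simps[OF assms])

lemma K_hom_Omega:
  assumes \<xi>: "\<xi> \<in> characters"
  shows "K_hom \<xi> \<in> Omega \<alpha>"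
proof -
  have "K_hom \<xi> (x + y) = K_hom \<xi> x + K_hom \<xi> y" "K_hom \<xi> (c *\<^sub>C x) = c *\<^sub>C K_hom \<xi> x"
    "K_hom \<xi> (x * y) = K_hom \<xi> x * K_hom \<xi> y" "K_hom \<xi> (star x) = star (K_hom \<xi> x)"
    "K_hom \<xi> 1 = 1" "K_hom \<xi> (\<alpha> x) = K_symmetry (K_hom \<xi> x)" for x y c
    by (simp_all add: K_hom_eq[OF \<xi>] T_ops \<alpha>_simps character_simps[OF \<xi>] character_star[OF \<xi>] field_simps)
  then show ?thesis
    by (auto simp: Omega_def unital_star_hom_def star_hom_def complex_linear_iff)
qed

lemma K_hom_comp:
  assumes \<xi>: "\<xi> \<in> characters"
  shows "K_hom (\<xi> \<circ> \<alpha>) = K_symmetry \<circ> K_hom \<xi>"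
  by (auto simp: K_hom_eq[OF \<xi>] K_hom_eq[OF character_comp[OF \<xi>]] \<alpha>_simps field_simps)

lemma Omega_eq_K_hom:
  assumes w: "w \<in> Omega \<alpha>"
  obtains \<xi> where "\<xi> \<in> characters" "w = K_hom \<xi>"
proof -
  \<comment> \<open>The sum \<open>a + b\<close> is the eigenvalue of \<open>T a b\<close> on the
    vector \<open>(1, 1)\<close>, hence multiplicative in the matrix. The other eigenvalue
    \<open>a - b\<close> would give the character composed with \<open>\<alpha>\<close>.\<close>
  define \<xi> where "\<xi> x = K_fst (w x) + K_snd (w x)" for x
  have w_simps: "w (x + y) = w x + w y" "w (c *\<^sub>C x) = c *\<^sub>C w x" "w (x * y) = w x * w y"
    "w (star x) = star (w x)" "w 1 = 1" "w (\<alpha> x) = K_symmetry (w x)" for x y c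
    using w by (auto simp: Omega_def unital_star_hom_def star_hom_def complex_linear_iff fun_eq_iff)
  have K_simps: "K_fst (k + l) = K_fst k + K_fst l" "K_snd (k + l) = K_snd k + K_snd l"
    "K_fst (c *\<^sub>C k) = c * K_fst k" "K_snd (c *\<^sub>C k) = c * K_snd k"
    "K_fst (k * l) = K_fst k * K_fst l + K_snd k * K_snd l"
    "K_snd (k * l) = K_fst k * K_snd l + K_snd k * K_fst l"
    "K_fst (star k) = cnj (K_fst k)" "K_snd (star k) = - cnj (K_snd k)"
    "K_fst 1 = 1" "K_snd 1 = 0"
    "K_fst (K_symmetry k) = K_fst k" "K_snd (K_symmetry k) = - K_snd k" for k l c
    by (cases k; cases l; simp add: T_ops)+
  have \<xi>: "\<xi> \<in> characters"
    by (simp add: characters_def \<xi>_def w_simps K_simps dagger_def algebra_simps)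
  moreover have "w = K_hom \<xi>"
  proof
    fix x
    have "K_hom \<xi> x = T (K_fst (w x)) (K_snd (w x))"
      by (simp add: K_hom_eq[OF \<xi>] \<xi>_def w_simps K_simps)
    then show "w x = K_hom \<xi> x" by simp
  qed
  ultimately show ?thesis by (rule that)
qed

definition point :: "('a \<Rightarrow> complex) \<Rightarrow> ('a \<Rightarrow> kmat) set"
  where "point \<xi> = Omega_rel \<alpha> `` {K_hom \<xi>}"

lemma point_image: "topspace (Omega_b \<alpha>) = point ` characters"
proof -
  have "Omega \<alpha> = K_hom ` characters"
    using Omega_eq_K_hom K_hom_Omega by blast
  then show ?thesis
    by (auto simp: topspace_Omega_b quotient_def point_def)
qed

text \<open>Composition with \<open>\<alpha>\<close> changes the homomorphism by the automorphism
  \<open>K_symmetry\<close>. Functions of the point are therefore \<alpha>-invariant functions of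
  the character, which \<open>gelfand_surj\<close> exploits.\<close>

lemma point_comp:
  assumes \<xi>: "\<xi> \<in> characters"
  shows "point (\<xi> \<circ> \<alpha>) = point \<xi>"
proof -
  have "unital_star_hom K_symmetry" "bij K_symmetry"
    using fundamental_symmetry_K by (auto simp: unital_star_hom_def fundamental_symmetry_def T_ops)
  then have "(K_hom \<xi>, K_hom (\<xi> \<circ> \<alpha>)) \<in> Omega_rel \<alpha>"
    unfolding Omega_rel_def using K_hom_Omega \<xi> character_comp[OF \<xi>] K_hom_comp[OF \<xi>] by blast
  then show ?thesis
    unfolding point_def using equiv_class_eq[OF equiv_Omega_rel] by metis
qed

section \<open>Topology of the base space\<close>

lemma continuous_map_point: "continuous_map (top_of_set characters) (Omega_b \<alpha>) point"
proof -
  \<comment> \<open>The topology of \<Omega> is generated by preimages under evaluations, so it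
    suffices to pull back these sets.\<close>
  have "continuous_map (top_of_set characters) (Omega_topology \<alpha>) K_hom"
    unfolding Omega_topology_def continuous_on_generated_topo_iff
  proof (intro conjI allI impI)
    fix V assume "V \<in> {{w \<in> Omega \<alpha>. w x \<in> U} | x U. open U}"
    then obtain x U where V: "V = {w \<in> Omega \<alpha>. w x \<in> U}" "open U" by blast
    have "continuous_on characters (\<lambda>\<xi>. K_hom \<xi> x)"
      unfolding K_hom_def
      by (intro continuous_on_T continuous_on_subset[OF continuous_on_product_coordinates]) auto
    then have "openin (top_of_set characters) (characters \<inter> (\<lambda>\<xi>. K_hom \<xi> x) -` U)"
      using V(2) by (simp add: continuous_openin_preimage_gen)
    moreover have "K_hom -` V \<inter> topspace (top_of_set characters) = characters \<inter> (\<lambda>\<xi>. K_hom \<xi> x) -` U"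
      using K_hom_Omega by (auto simp: V)
    ultimately show "openin (top_of_set characters) (K_hom -` V \<inter> topspace (top_of_set characters))"
      by simp
  next
    show "K_hom ` topspace (top_of_set characters) \<subseteq> \<Union> {{w \<in> Omega \<alpha>. w x \<in> U} | x U. open U}"
      using K_hom_Omega by (auto intro!: exI[of _ "UNIV :: kmat set"])
  qed
  then have "continuous_map (top_of_set characters) (Omega_b \<alpha>) ((\<lambda>w. Omega_rel \<alpha> `` {w}) \<circ> K_hom)"
    using quotient_imp_continuous_map[OF quotient_map_Omega_b] continuous_map_compose by blast
  then show ?thesis by (simp add: point_def[abs_def] comp_def)
qed

lemma compact_space_Omega_b: "compact_space (Omega_b \<alpha>)"
proof -
  have "compactin (top_of_set characters) characters"
    by (simp add: compactin_subtopology compact_characters)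
  then have "compactin (Omega_b \<alpha>) (point ` characters)"
    by (rule image_compactin[OF _ continuous_map_point])
  then show ?thesis by (simp add: compact_space_def point_image)
qed

section \<open>The transform at a point and separation of points\<close>

lemma half_eq: "a / 2 = b / 2 \<Longrightarrow> a = (b :: complex)"
  by simp

text \<open>The product of \<open>e\<close> with the odd component is even, so
  \<open>K_hom \<xi>\<close> sends it to a diagonal matrix; \<open>K_odd_symmetry\<close> moves this
  entry off the diagonal.\<close>

lemma gelfand_point:
  assumes \<xi>: "\<xi> \<in> characters"
  shows "gelfand \<alpha> \<epsilon> x (point \<xi>) = T ((\<xi> x + \<xi> (\<alpha> x)) / 2) (\<xi> e * (\<xi> x - \<xi> (\<alpha> x)) / 2)"
proof -
  have "\<xi> (\<alpha> (even_comp \<alpha> x)) = \<xi> (even_comp \<alpha> x)" "\<xi> (\<alpha> (odd_comp \<alpha> x)) = - \<xi> (odd_comp \<alpha> x)"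
    using even_odd_decomposition(1)[OF fundamental, of x]
    by (auto simp: even_part_def odd_part_def character_simps[OF \<xi>])
  then have "gelfand \<alpha> \<epsilon> x (point \<xi>) = T (\<xi> (even_comp \<alpha> x)) (\<xi> e * \<xi> (odd_comp \<alpha> x))"
    unfolding point_def gelfand_class[OF fundamental odd compatible K_hom_Omega[OF \<xi>]]
    by (simp add: K_hom_eq[OF \<xi>] T_ops \<epsilon>_eq \<alpha>_simps e_simps character_simps[OF \<xi>])
  then show ?thesis
    by (simp add: even_comp_def odd_comp_def character_simps[OF \<xi>])
qed

lemma continuous_map_gelfand: "continuous_map (Omega_b \<alpha>) euclidean (gelfand \<alpha> \<epsilon> x)"
proof (rule continuous_compose_quotient_map[OF quotient_map_Omega_b])
  have "continuous_map (Omega_topology \<alpha>) euclidean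
      (\<lambda>w. K_odd_symmetry (w (\<epsilon> (odd_comp \<alpha> x))))"
  proof -
    have "continuous_on UNIV K_odd_symmetry"
      unfolding K_odd_symmetry_eq[abs_def]
      by (intro continuous_on_T linear_continuous_on bounded_linear_K_fst bounded_linear_K_snd)
    then have "continuous_map euclidean euclidean K_odd_symmetry" by simp
    from continuous_map_compose[OF continuous_map_Omega_eval this] show ?thesis
      by (simp add: comp_def)
  qed
  then have "continuous_map (Omega_topology \<alpha>) euclidean
      (\<lambda>w. w (even_comp \<alpha> x) + K_odd_symmetry (w (\<epsilon> (odd_comp \<alpha> x))))"
    by (intro continuous_map_add continuous_map_Omega_eval)
  then show "continuous_map (Omega_topology \<alpha>) euclidean
      (gelfand \<alpha> \<epsilon> x \<circ> (\<lambda>w. Omega_rel \<alpha> `` {w}))"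
    by (rule continuous_map_eq) (simp add: topspace_Omega_topology gelfand_class[OF fundamental odd compatible])
qed

text \<open>The transforms determine \<open>\<xi>\<close> on even elements, and on odd elements up
  to the sign relating \<open>\<xi> e\<close> and \<open>\<eta> e\<close>. Equal signs give
  \<open>\<xi> = \<eta>\<close>, opposite signs \<open>\<xi> = \<eta> \<circ> \<alpha>\<close>; both
  represent the same point.\<close>

lemma point_eqI:
  assumes \<xi>: "\<xi> \<in> characters" and \<eta>: "\<eta> \<in> characters"
    and eq: "\<And>x. gelfand \<alpha> \<epsilon> x (point \<xi>) = gelfand \<alpha> \<epsilon> x (point \<eta>)"
  shows "point \<xi> = point \<eta>"
proof -
  have *: "\<xi> x + \<xi> (\<alpha> x) = \<eta> x + \<eta> (\<alpha> x)" "\<xi> e * (\<xi> x - \<xi> (\<alpha> x)) = \<eta> e * (\<eta> x - \<eta> (\<alpha> x))" for x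
    using eq[of x] unfolding gelfand_point[OF \<xi>] gelfand_point[OF \<eta>] T_eq_iff
    by (blast dest: half_eq)+
  consider "\<xi> e = \<eta> e" | "\<xi> e = - \<eta> e"
    using character_e[OF \<xi>] character_e[OF \<eta>] by fastforce
  then show ?thesis
  proof cases
    case 1
    have "\<xi> x = \<eta> x" for x
    proof -
      have "\<xi> x - \<xi> (\<alpha> x) = \<eta> x - \<eta> (\<alpha> x)"
        using *(2)[of x] 1 character_e[OF \<eta>] by auto
      then have "(\<xi> x + \<xi> (\<alpha> x)) + (\<xi> x - \<xi> (\<alpha> x)) = (\<eta> x + \<eta> (\<alpha> x)) + (\<eta> x - \<eta> (\<alpha> x))"
        using *(1)[of x] by (simp only:)
      then show ?thesis by simp
    qed
    then have "\<xi> = \<eta>" by blast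
    then show ?thesis by simp
  next
    case 2
    have "\<xi> x = (\<eta> \<circ> \<alpha>) x" for x
    proof -
      have "\<xi> x - \<xi> (\<alpha> x) = - (\<eta> x - \<eta> (\<alpha> x))"
        using *(2)[of x] 2 character_e[OF \<eta>] by (auto simp: algebra_simps)
      then have "(\<xi> x + \<xi> (\<alpha> x)) + (\<xi> x - \<xi> (\<alpha> x)) = (\<eta> x + \<eta> (\<alpha> x)) + - (\<eta> x - \<eta> (\<alpha> x))"
        using *(1)[of x] by (simp only:)
      then show ?thesis by simp
    qed
    then have "\<xi> = \<eta> \<circ> \<alpha>" by blast
    then show ?thesis using point_comp[OF \<eta>] by simp
  qed
qed

text \<open>The transforms are continuous into a metric space and separate points by
  \<open>point_eqI\<close>, so disjoint neighbourhoods can be pulled back.\<close>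

lemma Hausdorff_space_Omega_b: "Hausdorff_space (Omega_b \<alpha>)"
  unfolding Hausdorff_space_def
proof (intro allI impI)
  fix c d assume cd: "c \<in> topspace (Omega_b \<alpha>) \<and> d \<in> topspace (Omega_b \<alpha>) \<and> c \<noteq> d"
  then obtain x where x: "gelfand \<alpha> \<epsilon> x c \<noteq> gelfand \<alpha> \<epsilon> x d"
    using point_eqI unfolding point_image by blast
  let ?g = "gelfand \<alpha> \<epsilon> x"
  obtain U V where UV: "open U" "open V" "?g c \<in> U" "?g d \<in> V" "U \<inter> V = {}"
    using hausdorff[OF x] by blast
  let ?P = "\<lambda>U. {m \<in> topspace (Omega_b \<alpha>). ?g m \<in> U}"
  have "openin (Omega_b \<alpha>) (?P U)" "openin (Omega_b \<alpha>) (?P V)"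
    using UV(1,2) continuous_map_gelfand by (auto intro!: openin_continuous_map_preimage)
  moreover have "c \<in> ?P U" "d \<in> ?P V" "disjnt (?P U) (?P V)"
    using cd UV by (auto simp: disjnt_def)
  ultimately show "\<exists>U V. openin (Omega_b \<alpha>) U \<and> openin (Omega_b \<alpha>) V \<and> c \<in> U \<and> d \<in> V \<and> disjnt U V"
    by blast
qed

section \<open>The transform is an isometric isomorphism\<close>

lemma gelfand_extensional: "gelfand \<alpha> \<epsilon> x \<in> extensional (topspace (Omega_b \<alpha>))"
  by (simp add: gelfand_def topspace_Omega_b)

lemma gelfand_eqI:
  assumes "\<And>\<xi>. \<xi> \<in> characters \<Longrightarrow> gelfand \<alpha> \<epsilon> x (point \<xi>) = f (point \<xi>)"
  shows "gelfand \<alpha> \<epsilon> x = restrict f (topspace (Omega_b \<alpha>))"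
  by (rule extensionalityI[OF gelfand_extensional restrict_extensional])
     (auto simp: point_image assms)

text \<open>Multiplicativity rests on \<open>\<xi> e\<close> having square \<open>1\<close>. For the
  involution, \<open>character_star\<close> exchanges the roles of \<open>x\<close> and
  \<open>\<alpha> x\<close>, which produces the minus sign in the off-diagonal entry of
  \<open>star\<close>.\<close>

lemma gelfand_algebra_hom:
  "gelfand \<alpha> \<epsilon> (x + y) = (\<lambda>m\<in>topspace (Omega_b \<alpha>). gelfand \<alpha> \<epsilon> x m + gelfand \<alpha> \<epsilon> y m)"
  "gelfand \<alpha> \<epsilon> (c *\<^sub>C x) = (\<lambda>m\<in>topspace (Omega_b \<alpha>). c *\<^sub>C gelfand \<alpha> \<epsilon> x m)"
  "gelfand \<alpha> \<epsilon> (x * y) = (\<lambda>m\<in>topspace (Omega_b \<alpha>). gelfand \<alpha> \<epsilon> x m * gelfand \<alpha> \<epsilon> y m)"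
  "gelfand \<alpha> \<epsilon> (star x) = (\<lambda>m\<in>topspace (Omega_b \<alpha>). star (gelfand \<alpha> \<epsilon> x m))"
proof -
  show "gelfand \<alpha> \<epsilon> (x + y) = (\<lambda>m\<in>topspace (Omega_b \<alpha>). gelfand \<alpha> \<epsilon> x m + gelfand \<alpha> \<epsilon> y m)"
    "gelfand \<alpha> \<epsilon> (c *\<^sub>C x) = (\<lambda>m\<in>topspace (Omega_b \<alpha>). c *\<^sub>C gelfand \<alpha> \<epsilon> x m)"
    by (rule gelfand_eqI, simp add: gelfand_point T_ops \<alpha>_simps character_simps field_simps)+
  show "gelfand \<alpha> \<epsilon> (x * y) = (\<lambda>m\<in>topspace (Omega_b \<alpha>). gelfand \<alpha> \<epsilon> x m * gelfand \<alpha> \<epsilon> y m)"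
  proof (rule gelfand_eqI)
    fix \<xi> assume \<xi>: "\<xi> \<in> characters"
    show "gelfand \<alpha> \<epsilon> (x * y) (point \<xi>) = gelfand \<alpha> \<epsilon> x (point \<xi>) * gelfand \<alpha> \<epsilon> y (point \<xi>)"
      using character_e[OF \<xi>]
      by (auto simp: gelfand_point[OF \<xi>] T_ops \<alpha>_simps character_simps[OF \<xi>] field_simps)
  qed
  show "gelfand \<alpha> \<epsilon> (star x) = (\<lambda>m\<in>topspace (Omega_b \<alpha>). star (gelfand \<alpha> \<epsilon> x m))"
  proof (rule gelfand_eqI)
    fix \<xi> assume \<xi>: "\<xi> \<in> characters"
    show "gelfand \<alpha> \<epsilon> (star x) (point \<xi>) = star (gelfand \<alpha> \<epsilon> x (point \<xi>))"
      using character_e[OF \<xi>]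
      by (auto simp: gelfand_point[OF \<xi>] T_ops \<alpha>_simps character_star[OF \<xi>] field_simps)
  qed
qed

text \<open>The sum and the difference of the two entries are \<open>\<xi> x\<close> and
  \<open>\<xi> (\<alpha> x)\<close>, in an order that depends on the sign
  \<open>\<xi> e\<close>.\<close>

lemma norm_gelfand_point:
  assumes \<xi>: "\<xi> \<in> characters"
  shows "norm (gelfand \<alpha> \<epsilon> x (point \<xi>)) = max (cmod (\<xi> x)) (cmod (\<xi> (\<alpha> x)))"
proof -
  have "(a + b) / 2 + (a - b) / 2 = a" "(a + b) / 2 - (a - b) / 2 = b"
    "(a + b) / 2 - (b - a) / 2 = a" "(a + b) / 2 + (b - a) / 2 = b" for a b :: complex
    by (simp_all add: field_simps)
  then show ?thesis
    using character_e[OF \<xi>] by (auto simp: gelfand_point[OF \<xi>] T_ops max.commute)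
qed

text \<open>The supremum is attained: for \<open>x \<noteq> 0\<close> at a norming character, for
  \<open>x = 0\<close> by the inserted \<open>0\<close>, which also covers an empty base
  space.\<close>

lemma CK_norm_gelfand: "CK_norm (Omega_b \<alpha>) (gelfand \<alpha> \<epsilon> x) = norm x"
  unfolding CK_norm_def
proof (rule cSup_eq_maximum)
  have le: "norm (gelfand \<alpha> \<epsilon> x (point \<xi>)) \<le> norm x" if "\<xi> \<in> characters" for \<xi>
    using character_le_norm[OF that] character_le_norm[OF character_comp[OF that], of x]
    by (simp add: norm_gelfand_point that)
  then show "r \<le> norm x" if "r \<in> insert 0 ((\<lambda>m. norm (gelfand \<alpha> \<epsilon> x m)) ` topspace (Omega_b \<alpha>))" for r
    using that by (auto simp: point_image)
  show "norm x \<in> insert 0 ((\<lambda>m. norm (gelfand \<alpha> \<epsilon> x m)) ` topspace (Omega_b \<alpha>))"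
  proof (cases "x = 0")
    case False
    then obtain \<xi> where \<xi>: "\<xi> \<in> characters" "cmod (\<xi> x) = norm x"
      using norm_eq_character by blast
    then have "norm (gelfand \<alpha> \<epsilon> x (point \<xi>)) = norm x"
      using le[OF \<xi>(1)] by (simp add: norm_gelfand_point)
    then show ?thesis using \<xi>(1) by (force simp: point_image)
  qed simp
qed

text \<open>The entries of \<open>f\<close>, pulled back along \<open>point\<close>, are realised by
  elements \<open>p\<close> and \<open>q\<close>. By \<open>point_comp\<close> their character
  values are \<alpha>-invariant, so \<open>p\<close> behaves as an even and \<open>e * q\<close> as
  an odd element. The factor \<open>e\<close> cancels against the \<open>\<xi> e\<close> in
  \<open>gelfand_point\<close>.\<close>

lemma gelfand_surj:
  assumes f: "f \<in> CK (Omega_b \<alpha>)"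
  obtains x where "gelfand \<alpha> \<epsilon> x = f"
proof -
  have "continuous_map (top_of_set characters) euclidean (f \<circ> point)"
    using f continuous_map_point continuous_map_compose unfolding CK_def by blast
  then have cont: "continuous_on characters (\<lambda>\<xi>. f (point \<xi>))"
    by (simp add: comp_def)
  obtain p where p: "\<And>\<xi>. \<xi> \<in> characters \<Longrightarrow> \<xi> p = K_fst (f (point \<xi>))"
    using character_function_surj bounded_linear.continuous_on[OF bounded_linear_K_fst cont] by blast
  obtain q where q: "\<And>\<xi>. \<xi> \<in> characters \<Longrightarrow> \<xi> q = K_snd (f (point \<xi>))"
    using character_function_surj bounded_linear.continuous_on[OF bounded_linear_K_snd cont] by blast
  have "gelfand \<alpha> \<epsilon> (p + e * q) (point \<xi>) = f (point \<xi>)" if \<xi>: "\<xi> \<in> characters" for \<xi>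
  proof -
    have "\<xi> (\<alpha> p) = \<xi> p" "\<xi> (\<alpha> q) = \<xi> q"
      using p[OF character_comp[OF \<xi>]] q[OF character_comp[OF \<xi>]]
      by (simp_all add: p[OF \<xi>] q[OF \<xi>] point_comp[OF \<xi>])
    then have "gelfand \<alpha> \<epsilon> (p + e * q) (point \<xi>) = T (\<xi> p) (\<xi> q)"
      using character_e[OF \<xi>]
      by (auto simp: gelfand_point[OF \<xi>] \<alpha>_simps e_simps character_simps[OF \<xi>])
    then show ?thesis by (simp add: p[OF \<xi>] q[OF \<xi>])
  qed
  then have "gelfand \<alpha> \<epsilon> (p + e * q) = restrict f (topspace (Omega_b \<alpha>))"
    by (rule gelfand_eqI)
  also have "\<dots> = f"
    using f by (auto simp: CK_def extensional_restrict)
  finally show ?thesis by (rule that)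
qed

lemma inj_gelfand: "inj (gelfand \<alpha> \<epsilon>)"
proof (rule injI)
  fix x y assume eq: "gelfand \<alpha> \<epsilon> x = gelfand \<alpha> \<epsilon> y"
  have "\<xi> x = \<xi> y" if \<xi>: "\<xi> \<in> characters" for \<xi>
  proof -
    have plus: "\<xi> x + \<xi> (\<alpha> x) = \<xi> y + \<xi> (\<alpha> y)"
      and "\<xi> e * (\<xi> x - \<xi> (\<alpha> x)) = \<xi> e * (\<xi> y - \<xi> (\<alpha> y))"
      using fun_cong[OF eq, of "point \<xi>"]
      unfolding gelfand_point[OF \<xi>] T_eq_iff by (blast dest: half_eq)+
    then have "\<xi> x - \<xi> (\<alpha> x) = \<xi> y - \<xi> (\<alpha> y)"
      using character_e[OF \<xi>] by auto
    with plus have "(\<xi> x + \<xi> (\<alpha> x)) + (\<xi> x - \<xi> (\<alpha> x)) = (\<xi> y + \<xi> (\<alpha> y)) + (\<xi> y - \<xi> (\<alpha> y))"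
      by (simp only:)
    then show ?thesis by simp
  qed
  then show "x = y" by (rule character_separation)
qed

lemma isometric_star_iso_gelfand: "isometric_star_iso_CK (Omega_b \<alpha>) (gelfand \<alpha> \<epsilon>)"
proof -
  have "range (gelfand \<alpha> \<epsilon>) = CK (Omega_b \<alpha>)"
    using gelfand_surj continuous_map_gelfand gelfand_extensional unfolding CK_def by blast
  then have "bij_betw (gelfand \<alpha> \<epsilon>) UNIV (CK (Omega_b \<alpha>))"
    using inj_gelfand by (simp add: bij_betw_def)
  then show ?thesis
    unfolding isometric_star_iso_CK_def using gelfand_algebra_hom CK_norm_gelfand by blast
qed

end

text \<open>The topological conjuncts certify that the target is an algebra \<open>C(M, K)\<close>
  over a compact Hausdorff space.\<close>

theorem theorem3p27:
  fixes \<alpha> \<epsilon> :: "'a::{banach_star_algebra,comm_monoid_mult} \<Rightarrow> 'a"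
  assumes "fundamental_symmetry \<alpha>"
    and "odd_symmetry \<epsilon>"
    and "compatible_symmetries \<alpha> \<epsilon>"
    and "imprimitive \<alpha>"
  shows "compact_space (Omega_b \<alpha>) \<and> Hausdorff_space (Omega_b \<alpha>) \<and>
    isometric_star_iso_CK (Omega_b \<alpha>) (gelfand \<alpha> \<epsilon>)"
proof -
  interpret symmetric_krein \<alpha> \<epsilon>
    using assms(1-3) by unfold_locales
  show ?thesis
    using compact_space_Omega_b Hausdorff_space_Omega_b isometric_star_iso_gelfand by blast
qed

end
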